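(* Let $C$ be a weakly skew circuit of size $t$ and formal degree $d$. There is a depth four circuit $\Gamma$ computing the same polynomial as $C$ with at most $(t+1)^2+1$ unweighted addition gates and at most $2(t+1)^{\sqrt{3d}+2}$ multiplication gates. There is a depth four arithmetic formula $\Gamma_f$ computing the same polynomial with at most $(t+1)^{\sqrt{3d}}+1$ unweighted addition gates and at most $2(t+1)^{2\sqrt{3d}}$ multiplication gates. The inputs of $\Gamma$ and $\Gamma_f$ are inputs of $C$ or constants, and their multiplication gates have fan-in at most $\sqrt{3d}+1$. If $C$ is constant-free and all the addition gates of $C$ are ordinary additions or subtractions, then these constants are integers of absolute value at most $2^t$.
   Context: An arithmetic circuit has input gates labelled by variables or field constants (each of fan-out at most 1), multiplication gates, and addition gates, which may be weighted (computing $\sum a_ix_i$ from inputs $x_i$ with weights $a_i$); ordinary addition and subtraction gates are binary with weights $(1,1)$ and $(1,-1)$. Constant-free means the only constants are from $\{-1,0,1\}$. Size is the number of gates including inputs. Formal degree: 1 for inputs, max of inputs' formal degrees for addition gates, sum for multiplication gates; the circuit's formal degree is that of its output. A circuit with binary multiplication gates is weakly skew if for every multiplication gate $\alpha$, at least one of its two input gates $\beta$ has the property that the subcircuit computing $\beta$ is connected to the rest of the circuit only through the edge from $\beta$ to $\alpha$. A depth four circuit is a $\Sigma\Pi\Sigma\Pi$ circuit with gates of unbounded fan-in (output addition gate, then multiplication gates, then addition gates, then multiplication gates fed by input gates). An unweighted addition gate computes the sum of its inputs. A depth four formula is a depth four circuit where every non-output gate has fan-out one. *)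

theory Defs
  imports Complex_Main "HOL-Library.Poly_Mapping"
begin

type_synonym ('v, 'a) mpoly = "('v \<Rightarrow>\<^sub>0 nat) \<Rightarrow>\<^sub>0 'a"

definition mp_const :: "'a::zero \<Rightarrow> ('v, 'a) mpoly" where
  "mp_const c = Poly_Mapping.single 0 c"

definition mp_var :: "'v \<Rightarrow> ('v, 'a::zero_neq_one) mpoly" where
  "mp_var x = Poly_Mapping.single (Poly_Mapping.single x 1) 1"

text \<open>
  The gates of a circuit are listed in a topological order and refer to their inputs by position
  in that list. Parallel edges are allowed (a squaring gate is \<^term>\<open>Mult_Gate [j, j]\<close>),
  so an edge is given by its target gate together with a position in the input list of that gate.
\<close>

datatype ('v, 'a) gate =
    Var_Gate 'v
  | Const_Gate 'a
  | is_add: Add_Gate "('a \<times> nat) list"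
  | is_mult: Mult_Gate "nat list"

datatype ('v, 'a) circuit = Circuit (gates: "('v, 'a) gate list") (output_gate: nat)

fun is_input :: "('v, 'a) gate \<Rightarrow> bool" where
  "is_input (Var_Gate x) = True"
| "is_input (Const_Gate c) = True"
| "is_input (Add_Gate ws) = False"
| "is_input (Mult_Gate js) = False"

fun gate_args :: "('v, 'a) gate \<Rightarrow> nat list" where
  "gate_args (Var_Gate x) = []"
| "gate_args (Const_Gate c) = []"
| "gate_args (Add_Gate ws) = map snd ws"
| "gate_args (Mult_Gate js) = js"

definition circuit_size :: "('v, 'a) circuit \<Rightarrow> nat" where
  "circuit_size C = length (gates C)"

abbreviation gate_at :: "('v, 'a) circuit \<Rightarrow> nat \<Rightarrow> ('v, 'a) gate" where
  "gate_at C i \<equiv> gates C ! i"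

definition args :: "('v, 'a) circuit \<Rightarrow> nat \<Rightarrow> nat list" where
  "args C i = gate_args (gate_at C i)"

definition fan_out :: "('v, 'a) circuit \<Rightarrow> nat \<Rightarrow> nat" where
  "fan_out C j = (\<Sum>i<circuit_size C. count_list (args C i) j)"

definition is_circuit :: "('v, 'a) circuit \<Rightarrow> bool" where
  "is_circuit C \<longleftrightarrow>
     output_gate C < circuit_size C \<and>
     (\<forall>i<circuit_size C.
        (\<forall>j\<in>set (args C i). j < i) \<and>
        (is_input (gate_at C i) \<longrightarrow> fan_out C i \<le> 1) \<and>
        (\<not> is_input (gate_at C i) \<longrightarrow> args C i \<noteq> []))"

text \<open>
  Bottom-up evaluation: \<^term>\<open>f\<close> computes the result of a gate from the list of results
  of all the gates preceding it.
\<close>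

definition run :: "('b list \<Rightarrow> ('v, 'a) gate \<Rightarrow> 'b) \<Rightarrow> ('v, 'a) gate list \<Rightarrow> 'b list" where
  "run f gs = foldl (\<lambda>rs g. rs @ [f rs g]) [] gs"

fun gate_value :: "('v, 'a::comm_ring_1) mpoly list \<Rightarrow> ('v, 'a) gate \<Rightarrow> ('v, 'a) mpoly" where
  "gate_value vs (Var_Gate x) = mp_var x"
| "gate_value vs (Const_Gate c) = mp_const c"
| "gate_value vs (Add_Gate ws) = (\<Sum>(a, j)\<leftarrow>ws. mp_const a * vs ! j)"
| "gate_value vs (Mult_Gate js) = (\<Prod>j\<leftarrow>js. vs ! j)"

definition computed_poly :: "('v, 'a::comm_ring_1) circuit \<Rightarrow> ('v, 'a) mpoly" where
  "computed_poly C = run gate_value (gates C) ! output_gate C"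

fun gate_degree :: "nat list \<Rightarrow> ('v, 'a) gate \<Rightarrow> nat" where
  "gate_degree ds (Var_Gate x) = 1"
| "gate_degree ds (Const_Gate c) = 1"
| "gate_degree ds (Add_Gate ws) = Max ((\<lambda>(a, j). ds ! j) ` set ws)"
| "gate_degree ds (Mult_Gate js) = (\<Sum>j\<leftarrow>js. ds ! j)"

definition formal_degree :: "('v, 'a) circuit \<Rightarrow> nat" where
  "formal_degree C = run gate_degree (gates C) ! output_gate C"

definition edges :: "('v, 'a) circuit \<Rightarrow> (nat \<times> nat) set" where
  "edges C = {(j, i). i < circuit_size C \<and> j \<in> set (args C i)}"

definition subcircuit :: "('v, 'a) circuit \<Rightarrow> nat \<Rightarrow> nat set" where
  "subcircuit C b = {g. (g, b) \<in> (edges C)\<^sup>*}"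

text \<open>
  \<^term>\<open>subcircuit C b\<close> is closed under taking inputs, so edges between it and the rest of
  the circuit can only leave it.
\<close>

definition connected_only_through :: "('v, 'a) circuit \<Rightarrow> nat \<Rightarrow> nat \<Rightarrow> bool" where
  "connected_only_through C i p \<longleftrightarrow>
     (let S = subcircuit C (args C i ! p) in
      \<forall>k<circuit_size C. \<forall>q<length (args C k).
        args C k ! q \<in> S \<and> k \<notin> S \<longrightarrow> k = i \<and> q = p)"

definition weakly_skew :: "('v, 'a) circuit \<Rightarrow> bool" where
  "weakly_skew C \<longleftrightarrow>
     (\<forall>i<circuit_size C. is_mult (gate_at C i) \<longrightarrow>
        length (args C i) = 2 \<and> (\<exists>p<2. connected_only_through C i p))"

fun gate_consts :: "('v, 'a) gate \<Rightarrow> 'a set" where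
  "gate_consts (Var_Gate x) = {}"
| "gate_consts (Const_Gate c) = {c}"
| "gate_consts (Add_Gate ws) = fst ` set ws"
| "gate_consts (Mult_Gate js) = {}"

definition constant_free :: "('v, 'a::ring_1) circuit \<Rightarrow> bool" where
  "constant_free C \<longleftrightarrow> (\<forall>g\<in>set (gates C). gate_consts g \<subseteq> {-1, 0, 1})"

definition ordinary_additions :: "('v, 'a::ring_1) circuit \<Rightarrow> bool" where
  "ordinary_additions C \<longleftrightarrow>
     (\<forall>ws. Add_Gate ws \<in> set (gates C) \<longrightarrow> map fst ws = [1, 1] \<or> map fst ws = [1, -1])"

definition unweighted_additions :: "('v, 'a::one) circuit \<Rightarrow> bool" where
  "unweighted_additions C \<longleftrightarrow>
     (\<forall>ws. Add_Gate ws \<in> set (gates C) \<longrightarrow> (\<forall>(a, j)\<in>set ws. a = 1))"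

definition num_add_gates :: "('v, 'a) circuit \<Rightarrow> nat" where
  "num_add_gates C = card {i. i < circuit_size C \<and> is_add (gate_at C i)}"

definition num_mult_gates :: "('v, 'a) circuit \<Rightarrow> nat" where
  "num_mult_gates C = card {i. i < circuit_size C \<and> is_mult (gate_at C i)}"

definition depth_four_circuit :: "('v, 'a) circuit \<Rightarrow> bool" where
  "depth_four_circuit C \<longleftrightarrow> is_circuit C \<and>
     (\<exists>level :: nat \<Rightarrow> nat. \<forall>i<circuit_size C.
        (is_input (gate_at C i) \<longrightarrow> level i = 0) \<and>
        (is_mult (gate_at C i) \<longrightarrow> level i \<in> {1, 3}) \<and>
        (is_add (gate_at C i) \<longrightarrow> level i \<in> {2, 4}) \<and>
        (level i = 4 \<longleftrightarrow> i = output_gate C) \<and>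
        (\<forall>j\<in>set (args C i). level i = Suc (level j)))"

definition depth_four_formula :: "('v, 'a) circuit \<Rightarrow> bool" where
  "depth_four_formula C \<longleftrightarrow> depth_four_circuit C \<and>
     (\<forall>i<circuit_size C. i \<noteq> output_gate C \<longrightarrow> fan_out C i = 1)"

definition inputs_from :: "('v, 'a) circuit \<Rightarrow> ('v, 'a) circuit \<Rightarrow> bool" where
  "inputs_from C D \<longleftrightarrow>
     (\<forall>g\<in>set (gates D). is_input g \<longrightarrow> g \<in> set (gates C) \<or> (\<exists>c. g = Const_Gate c))"

definition mult_fan_in_le :: "('v, 'a) circuit \<Rightarrow> real \<Rightarrow> bool" where
  "mult_fan_in_le C r \<longleftrightarrow>
     (\<forall>js. Mult_Gate js \<in> set (gates C) \<longrightarrow> real (length js) \<le> r)"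

definition input_constants_int_le :: "('v, 'a::ring_1) circuit \<Rightarrow> int \<Rightarrow> bool" where
  "input_constants_int_le C B \<longleftrightarrow>
     (\<forall>c. Const_Gate c \<in> set (gates C) \<longrightarrow> (\<exists>n::int. c = of_int n \<and> \<bar>n\<bar> \<le> B))"

end

theory Submission imports Defs begin

text \<open>
  Choose for every multiplication gate \<open>i\<close> a closed argument \<open>cl i\<close>; let \<open>op i\<close> be the other one.
  Multiply the value of each gate \<open>g\<close> by the values of \<open>op i\<close> for all \<open>i\<close> whose closed argument has
  \<open>g\<close> in its subcircuit. These products satisfy a linear system: multiplication gates just copy the
  product of their closed argument, addition gates stay linear, and at an input \<open>x\<close> the product is
  the label of \<open>x\<close> times the product at \<open>op i\<close> for the innermost such \<open>i\<close> (the origin of \<open>x\<close>).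
  Contracting everything but the inputs gives constants \<open>K\<close>, signed counts of paths and hence at most
  \<open>2 ^ t\<close> in absolute value in the constant-free case, such that the output is an entry of \<open>(K L) ^ N\<close>
  for every \<open>N \<ge> d\<close>, where \<open>L\<close> is the matrix of input labels on \<open>t + 1\<close> vertices. The accumulated
  formal degree drops by one at each input, so no path has more than \<open>d\<close> of them.

  With \<open>k = \<lfloor>sqrt (3 d)\<rfloor>\<close> and \<open>e = (k + 1) div 2\<close> we have \<open>d \<le> e k\<close>, so the
  entries of \<open>(K L) ^ e\<close> form the lower two levels (fan-in \<open>2 e \<le> k + 1\<close>) and the \<open>k\<close>-th power of
  that matrix the upper two.
\<close>

section \<open>Evaluation of circuits\<close>

lemma run_snoc: "run f (gs @ [g]) = run f gs @ [f (run f gs) g]"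
  by (simp add: run_def)

lemma length_run [simp]: "length (run f gs) = length gs"
  by (induction gs rule: rev_induct) (simp_all add: run_snoc, simp add: run_def)

lemma nth_run: "i < length gs \<Longrightarrow> run f gs ! i = f (take i (run f gs)) (gs ! i)"
proof (induction gs rule: rev_induct)
  case (snoc g gs)
  then show ?case
    by (cases "i < length gs") (auto simp: run_snoc nth_append less_Suc_eq)
qed simp

lemma gate_value_cong:
  assumes "\<And>j. j \<in> set (gate_args g) \<Longrightarrow> vs ! j = ws ! j"
  shows "gate_value vs g = gate_value ws g"
proof (cases g)
  case (Add_Gate xs)
  have "map (\<lambda>(a, j). mp_const a * vs ! j) xs = map (\<lambda>(a, j). mp_const a * ws ! j) xs"
    by (rule map_cong) (use assms Add_Gate in \<open>force+\<close>)
  then show ?thesis unfolding Add_Gate gate_value.simps by (rule arg_cong)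
next
  case (Mult_Gate js)
  have "map ((!) vs) js = map ((!) ws) js"
    by (rule map_cong) (use assms Mult_Gate in auto)
  then show ?thesis unfolding Mult_Gate gate_value.simps by (rule arg_cong)
qed auto

lemma gate_degree_cong:
  assumes "\<And>j. j \<in> set (gate_args g) \<Longrightarrow> ds ! j = es ! j"
  shows "gate_degree ds g = gate_degree es g"
proof (cases g)
  case (Add_Gate xs)
  have "(\<lambda>(a, j). ds ! j) ` set xs = (\<lambda>(a, j). es ! j) ` set xs"
    by (rule image_cong) (use assms Add_Gate in \<open>force+\<close>)
  then show ?thesis using Add_Gate by simp
next
  case (Mult_Gate js)
  have "map ((!) ds) js = map ((!) es) js"
    by (rule map_cong) (use assms Mult_Gate in auto)
  then show ?thesis unfolding Mult_Gate gate_degree.simps by (rule arg_cong)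
qed auto

lemma is_circuit_argsD:
  assumes "is_circuit C" "i < circuit_size C" "j \<in> set (args C i)"
  shows "j < i"
  using assms by (auto simp: is_circuit_def)

text \<open>Arguments precede their gate, so cutting the list of results at \<open>i\<close> loses
  nothing. The fold thereby becomes a system of equations over one fixed list.\<close>

lemma run_gate_value:
  assumes "is_circuit C" "i < circuit_size C"
  shows "run gate_value (gates C) ! i = gate_value (run gate_value (gates C)) (gate_at C i)"
proof -
  have "run gate_value (gates C) ! i = gate_value (take i (run gate_value (gates C))) (gate_at C i)"
    using assms by (simp add: nth_run circuit_size_def)
  also have "\<dots> = gate_value (run gate_value (gates C)) (gate_at C i)"
    by (rule gate_value_cong) (use is_circuit_argsD[OF assms] in \<open>simp add: args_def\<close>)
  finally show ?thesis .
qed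

lemma run_gate_degree:
  assumes "is_circuit C" "i < circuit_size C"
  shows "run gate_degree (gates C) ! i = gate_degree (run gate_degree (gates C)) (gate_at C i)"
proof -
  have "run gate_degree (gates C) ! i = gate_degree (take i (run gate_degree (gates C))) (gate_at C i)"
    using assms by (simp add: nth_run circuit_size_def)
  also have "\<dots> = gate_degree (run gate_degree (gates C)) (gate_at C i)"
    by (rule gate_degree_cong) (use is_circuit_argsD[OF assms] in \<open>simp add: args_def\<close>)
  finally show ?thesis .
qed

lemma count_list_concat: "count_list (concat xss) x = (\<Sum>xs\<leftarrow>xss. count_list xs x)"
  by (induction xss) simp_all

lemma count_list_upt: "count_list [m..<n] i = (if m \<le> i \<and> i < n then 1 else 0)"
  by (induction n) auto

text \<open>For an assembled circuit the concatenation of all argument lists has a closed form, from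
  which every fan-out can be read off.\<close>

lemma fan_out_eq_count_list: "fan_out C j = count_list (concat (map gate_args (gates C))) j"
proof -
  have "fan_out C j = (\<Sum>i\<leftarrow>[0..<length (gates C)]. count_list (gate_args (gates C ! i)) j)"
    by (simp add: fan_out_def args_def circuit_size_def sum_list_sum_nth atLeast0LessThan)
  also have "\<dots> = (\<Sum>g\<leftarrow>map ((!) (gates C)) [0..<length (gates C)]. count_list (gate_args g) j)"
    by (simp add: comp_def)
  also have "\<dots> = count_list (concat (map gate_args (gates C))) j"
    by (simp only: map_nth count_list_concat map_map comp_def)
  finally show ?thesis .
qed

lemma mp_const_0 [simp]: "mp_const 0 = 0"
  by (simp add: mp_const_def)

lemma mp_const_1 [simp]: "mp_const 1 = 1"
  by (simp add: mp_const_def)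

lemma mp_const_add: "mp_const (a + b) = mp_const a + mp_const b"
  by (simp add: mp_const_def single_add)

lemma mp_const_mult: "mp_const (a * b) = mp_const a * mp_const b"
  by (simp add: mp_const_def mult_single)

lemma mp_const_sum_list: "mp_const (\<Sum>x\<leftarrow>xs. f x) = (\<Sum>x\<leftarrow>xs. mp_const (f x))"
  by (induction xs) (simp_all add: mp_const_add)

section \<open>Assembling depth four circuits\<close>

text \<open>Argument lists for a level that consumes the level below in order: each lower gate is
  used exactly once, as fan-out one demands.\<close>

fun ranges :: "nat \<Rightarrow> nat list \<Rightarrow> nat list list" where
  "ranges m [] = []"
| "ranges m (n # ns) = [m..<m + n] # ranges (m + n) ns"

lemma length_ranges [simp]: "length (ranges m ns) = length ns"
  by (induction ns arbitrary: m) simp_all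

lemma concat_ranges: "concat (ranges m ns) = [m..<m + sum_list ns]"
proof (induction ns arbitrary: m)
  case (Cons n ns)
  have "[m..<m + n + sum_list ns] = [m..<m + n] @ [m + n..<m + n + sum_list ns]"
    by (rule upt_add_eq_append) simp
  with Cons show ?case by (simp add: add.assoc)
qed simp

lemma set_ranges: "js \<in> set (ranges m ns) \<Longrightarrow> set js \<subseteq> {m..<m + sum_list ns}"
  using arg_cong[OF concat_ranges[of m ns], of set] by auto

lemma length_in_ranges: "js \<in> set (ranges m ns) \<Longrightarrow> length js \<in> set ns"
  by (induction ns arbitrary: m) auto

text \<open>Carries known results of one level to the next: \<open>f\<close> reads results by
  position, \<open>h\<close> gives the intended values, and regrouping by \<open>ranges\<close>
  recovers the nesting of \<open>xss\<close>.\<close>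

lemma map_ranges:
  assumes "map f [m..<m + length (concat xss)] = map h (concat xss)"
  shows "map (map f) (ranges m (map length xss)) = map (map h) xss"
  using assms
proof (induction xss arbitrary: m)
  case (Cons xs xss)
  have "[m..<m + length (concat (xs # xss))] =
      [m..<m + length xs] @ [m + length xs..<m + length xs + length (concat xss)]"
    unfolding concat.simps length_append add.assoc[symmetric] by (rule upt_add_eq_append) simp
  with Cons.prems have "map f [m..<m + length xs] = map h xs"
    "map f [m + length xs..<m + length xs + length (concat xss)] = map h (concat xss)"
    by (simp_all add: append_eq_append_conv)
  with Cons.IH show ?case by simp
qed simp

text \<open>
  \<open>Bs ! k\<close> is a \<open>\<Sigma>\<Pi>\<close> block, given as a list of monomials over input gates; \<open>P\<close> lists, for every
  summand of the output, the indices of the blocks to be multiplied.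
\<close>

definition assemble ::
    "('v, 'a::one) gate list list list \<Rightarrow> nat list list \<Rightarrow> ('v, 'a) circuit" where
  "assemble Bs P =
    (let ms = concat Bs; ls = concat ms;
         a = length ls; b = a + length ms; c = b + length Bs; e = c + length P in
     Circuit
       (ls @ map Mult_Gate (ranges 0 (map length ms))
           @ map (\<lambda>js. Add_Gate (map (Pair 1) js)) (ranges a (map length Bs))
           @ map (\<lambda>js. Mult_Gate (map ((+) b) js)) P
           @ [Add_Gate (map (Pair 1) [c..<e])])
       e)"

abbreviation leaf_value :: "('v, 'a::comm_ring_1) gate \<Rightarrow> ('v, 'a) mpoly" where
  "leaf_value \<equiv> gate_value []"

definition block_value :: "('v, 'a::comm_ring_1) gate list list \<Rightarrow> ('v, 'a) mpoly" where
  "block_value B = (\<Sum>m\<leftarrow>B. \<Prod>g\<leftarrow>m. leaf_value g)"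

locale depth_four_assembly =
  fixes Bs :: "('v, 'a::comm_ring_1) gate list list list" and P :: "nat list list"
  assumes leaves: "\<And>B m g. B \<in> set Bs \<Longrightarrow> m \<in> set B \<Longrightarrow> g \<in> set m \<Longrightarrow> is_input g"
    and monomial_nonempty: "\<And>B m. B \<in> set Bs \<Longrightarrow> m \<in> set B \<Longrightarrow> m \<noteq> []"
    and block_nonempty: "\<And>B. B \<in> set Bs \<Longrightarrow> B \<noteq> []"
    and product_nonempty: "\<And>js. js \<in> set P \<Longrightarrow> js \<noteq> []"
    and P_nonempty: "P \<noteq> []"
    and indices: "\<And>js j. js \<in> set P \<Longrightarrow> j \<in> set js \<Longrightarrow> j < length Bs"
begin

definition "ms = concat Bs"
definition "ls = concat ms"
text \<open>Level boundaries: leaves fill \<open>[0..<a]\<close>, monomials \<open>[a..<b]\<close>,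
  blocks \<open>[b..<c]\<close>, products \<open>[c..<e]\<close>, and the output sits at
  \<open>e\<close>.\<close>

definition "a = length ls"
definition "b = a + length ms"
definition "c = b + length Bs"
definition "e = c + length P"

abbreviation "D \<equiv> assemble Bs P"

lemma gates_D:
  "gates D = ls @ map Mult_Gate (ranges 0 (map length ms))
           @ map (\<lambda>js. Add_Gate (map (Pair 1) js)) (ranges a (map length Bs))
           @ map (\<lambda>js. Mult_Gate (map ((+) b) js)) P
           @ [Add_Gate (map (Pair 1) [c..<e])]"
  by (simp add: assemble_def Let_def ms_def ls_def a_def b_def c_def e_def)

lemma output_D: "output_gate D = e"
  by (simp add: assemble_def Let_def ms_def ls_def a_def b_def c_def e_def)

lemma size_D: "circuit_size D = Suc e"
  by (simp add: circuit_size_def gates_D a_def b_def c_def e_def)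

lemma order: "a \<le> b" "b \<le> c" "c \<le> e"
  by (simp_all add: b_def c_def e_def)

lemma sum_lengths: "sum_list (map length ms) = a" "sum_list (map length Bs) = length ms"
  by (simp_all add: a_def ls_def ms_def length_concat)

lemma level_cases:
  assumes "i < Suc e"
  obtains "i < a" | "a \<le> i" "i < b" | "b \<le> i" "i < c" | "c \<le> i" "i < e" | "i = e"
  using assms order by linarith

lemma gate_leaf: "i < a \<Longrightarrow> gate_at D i = ls ! i"
  by (simp add: gates_D nth_append a_def)

lemma gate_mono: "a \<le> i \<Longrightarrow> i < b \<Longrightarrow>
    gate_at D i = Mult_Gate (ranges 0 (map length ms) ! (i - a))"
  by (auto simp: gates_D nth_append a_def b_def)

lemma gate_block: "b \<le> i \<Longrightarrow> i < c \<Longrightarrow>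
    gate_at D i = Add_Gate (map (Pair 1) (ranges a (map length Bs) ! (i - b)))"
  by (auto simp: gates_D nth_append a_def b_def c_def diff_diff_eq)

lemma gate_product: "c \<le> i \<Longrightarrow> i < e \<Longrightarrow>
    gate_at D i = Mult_Gate (map ((+) b) (P ! (i - c)))"
  by (auto simp: gates_D nth_append a_def b_def c_def e_def diff_diff_eq add.assoc)

lemma gate_output: "gate_at D e = Add_Gate (map (Pair 1) [c..<e])"
  by (auto simp: gates_D nth_append a_def b_def c_def e_def diff_diff_eq add.assoc)

lemma leaf_is_input: "i < a \<Longrightarrow> is_input (gate_at D i)"
  using nth_mem[of i ls] leaves by (auto simp: gate_leaf a_def ls_def ms_def)

lemma args_leaf: "i < a \<Longrightarrow> args D i = []"
  using leaf_is_input[of i] by (cases "gate_at D i") (auto simp: args_def)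

lemma args_mono:
  assumes "a \<le> i" "i < b"
  shows "set (args D i) \<subseteq> {0..<a}" "args D i \<noteq> []"
proof -
  let ?r = "ranges 0 (map length ms) ! (i - a)"
  have r: "?r \<in> set (ranges 0 (map length ms))"
    by (rule nth_mem) (use assms in \<open>simp add: b_def\<close>)
  show "set (args D i) \<subseteq> {0..<a}"
    using set_ranges[OF r] assms by (simp add: args_def gate_mono sum_lengths)
  show "args D i \<noteq> []"
    using length_in_ranges[OF r] monomial_nonempty assms
    by (auto simp: args_def gate_mono ms_def)
qed

lemma args_block:
  assumes "b \<le> i" "i < c"
  shows "set (args D i) \<subseteq> {a..<b}" "args D i \<noteq> []"
proof -
  let ?r = "ranges a (map length Bs) ! (i - b)"
  have r: "?r \<in> set (ranges a (map length Bs))"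
    by (rule nth_mem) (use assms in \<open>simp add: c_def\<close>)
  show "set (args D i) \<subseteq> {a..<b}"
    using set_ranges[OF r] assms by (simp add: args_def gate_block sum_lengths b_def comp_def)
  show "args D i \<noteq> []"
    using length_in_ranges[OF r] block_nonempty assms
    by (auto simp: args_def gate_block)
qed

lemma args_product:
  assumes "c \<le> i" "i < e"
  shows "set (args D i) \<subseteq> {b..<c}" "args D i \<noteq> []"
proof -
  have r: "P ! (i - c) \<in> set P"
    by (rule nth_mem) (use assms in \<open>simp add: e_def\<close>)
  show "set (args D i) \<subseteq> {b..<c}"
    using indices[OF r] assms by (auto simp: args_def gate_product c_def)
  show "args D i \<noteq> []"
    using product_nonempty[OF r] assms by (auto simp: args_def gate_product)
qed

lemma args_output: "args D e = [c..<e]" "args D e \<noteq> []"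
proof -
  show *: "args D e = [c..<e]"
    by (simp add: args_def gate_output comp_def)
  show "args D e \<noteq> []"
    using P_nonempty unfolding * by (simp add: e_def)
qed

text \<open>Monomials contribute \<open>[0..<a]\<close> and blocks \<open>[a..<b]\<close>, so
  leaves, monomials and products have fan-out 1 by construction. Only blocks can be shared, through
  repetitions in \<open>P\<close>.\<close>

lemma concat_args:
  "concat (map gate_args (gates D)) = [0..<b] @ concat (map (map ((+) b)) P) @ [c..<e]"
proof -
  have "gate_args g = []" if "g \<in> set ls" for g
  proof -
    have "is_input g" using that leaves by (auto simp: ls_def ms_def)
    then show ?thesis by (cases g) auto
  qed
  then have 1: "concat (map gate_args ls) = []" by simp
  have "[0..<b] = [0..<a] @ [a..<b]"
    unfolding b_def by (rule upt_add_eq_append) simp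
  then show ?thesis
    by (simp add: gates_D 1 comp_def concat_ranges sum_lengths b_def)
qed

lemma fan_out_leaf:
  assumes "i < a"
  shows "fan_out D i = 1"
proof -
  have "count_list (concat (map (map ((+) b)) P)) i = 0"
    using assms order by (auto simp: count_list_0_iff)
  then show ?thesis
    using assms order by (simp add: fan_out_eq_count_list concat_args count_list_upt)
qed

lemma is_circuit_D: "is_circuit D"
proof -
  have "(\<forall>j\<in>set (args D i). j < i) \<and> (is_input (gate_at D i) \<longrightarrow> fan_out D i \<le> 1) \<and>
      (\<not> is_input (gate_at D i) \<longrightarrow> args D i \<noteq> [])" if "i < Suc e" for i
    using that
  proof (cases rule: level_cases)
    case 1
    then show ?thesis by (simp add: args_leaf fan_out_leaf leaf_is_input)
  next
    case 2
    then show ?thesis using args_mono[of i] by (auto simp: gate_mono)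
  next
    case 3
    then show ?thesis using args_block[of i] order by (auto simp: gate_block)
  next
    case 4
    then show ?thesis using args_product[of i] order by (auto simp: gate_product)
  next
    case 5
    then show ?thesis using args_output order by (auto simp: gate_output)
  qed
  then show ?thesis by (simp add: is_circuit_def size_D output_D)
qed

lemma depth_four_circuit_D: "depth_four_circuit D"
proof -
  define level :: "nat \<Rightarrow> nat" where
    "level i = (if i < a then 0 else if i < b then 1 else if i < c then 2
      else if i < e then 3 else 4)" for i
  have "(is_input (gate_at D i) \<longrightarrow> level i = 0) \<and>
        (is_mult (gate_at D i) \<longrightarrow> level i \<in> {1, 3}) \<and>
        (is_add (gate_at D i) \<longrightarrow> level i \<in> {2, 4}) \<and>
        (level i = 4 \<longleftrightarrow> i = output_gate D) \<and>
        (\<forall>j\<in>set (args D i). level i = Suc (level j))" if "i < Suc e" for i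
    using that
  proof (cases rule: level_cases)
    case 1
    then have "\<not> is_mult (gate_at D i)" "\<not> is_add (gate_at D i)"
      using leaf_is_input[of i] by (cases "gate_at D i"; simp)+
    with 1 show ?thesis using order by (auto simp: args_leaf output_D level_def)
  next
    case 2
    then show ?thesis using args_mono[of i] order by (auto simp: gate_mono output_D level_def)
  next
    case 3
    then show ?thesis using args_block[of i] order by (auto simp: gate_block output_D level_def)
  next
    case 4
    then show ?thesis using args_product[of i] order
      by (auto simp: gate_product output_D level_def)
  next
    case 5
    then show ?thesis using args_output order by (auto simp: gate_output output_D level_def)
  qed
  then show ?thesis
    unfolding depth_four_circuit_def size_D using is_circuit_D by blast
qed

text \<open>The hypothesis turns the middle segment of \<open>concat_args\<close> into
  \<open>[b..<c]\<close>, so blocks too are used once.\<close>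

lemma depth_four_formula_D:
  assumes "concat P = [0..<length Bs]"
  shows "depth_four_formula D"
proof -
  have "concat (map (map ((+) b)) P) = map ((+) b) (concat P)"
    by (simp add: map_concat)
  also have "\<dots> = [b..<c]"
    by (rule nth_equalityI) (simp_all add: assms c_def)
  finally have "fan_out D i = 1" if "i < e" for i
    using that order by (auto simp: fan_out_eq_count_list concat_args count_list_upt)
  then show ?thesis
    by (auto simp: depth_four_formula_def depth_four_circuit_D size_D output_D)
qed

lemma computed_poly_D:
  "computed_poly D = (\<Sum>js\<leftarrow>P. \<Prod>j\<leftarrow>js. block_value (Bs ! j))"
proof -
  define vs where "vs = run gate_value (gates D)"
  have vs: "vs ! i = gate_value vs (gate_at D i)" if "i < Suc e" for i
    using run_gate_value[OF is_circuit_D, of i] that by (simp add: vs_def size_D)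
  have leaves': "map ((!) vs) [0..<0 + length (concat ms)] = map leaf_value (concat ms)"
  proof (rule nth_equalityI)
    fix i assume "i < length (map ((!) vs) [0..<0 + length (concat ms)])"
    then have i: "i < a" by (simp add: a_def ls_def)
    have "gate_value vs (ls ! i) = leaf_value (ls ! i)"
      using leaf_is_input[OF i] by (cases "ls ! i") (simp_all add: gate_leaf i)
    with i vs[of i] order show "map ((!) vs) [0..<0 + length (concat ms)] ! i = map leaf_value (concat ms) ! i"
      by (simp add: gate_leaf a_def ls_def)
  qed simp
  have monomials: "map ((!) vs) [a..<a + length (concat Bs)] =
      map (\<lambda>m. prod_list (map leaf_value m)) (concat Bs)"
  proof -
    have "map ((!) vs) [a..<a + length (concat Bs)] =
        map prod_list (map (map ((!) vs)) (ranges 0 (map length ms)))"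
      using order by (intro nth_equalityI) (auto simp: vs gate_mono b_def ms_def)
    also have "\<dots> = map prod_list (map (map leaf_value) ms)"
      by (simp only: map_ranges[OF leaves'])
    finally show ?thesis by (simp add: ms_def)
  qed
  have blocks: "map ((!) vs) [b..<c] = map block_value Bs"
  proof -
    have "map ((!) vs) [b..<c] = map sum_list (map (map ((!) vs)) (ranges a (map length Bs)))"
      using order by (intro nth_equalityI) (auto simp: vs gate_block c_def comp_def)
    also have "\<dots> = map sum_list (map (map (\<lambda>m. prod_list (map leaf_value m))) Bs)"
      by (simp only: map_ranges[OF monomials])
    finally show ?thesis by (simp add: block_value_def comp_def)
  qed
  have block: "vs ! (b + j) = block_value (Bs ! j)" if "j < length Bs" for j
    using arg_cong[OF blocks, of "\<lambda>xs. xs ! j"] that by (simp add: c_def)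
  have products: "map ((!) vs) [c..<e] = map (\<lambda>js. \<Prod>j\<leftarrow>js. block_value (Bs ! j)) P"
  proof (rule nth_equalityI)
    fix i assume "i < length (map ((!) vs) [c..<e])"
    then have i: "i < length P" by (simp add: e_def)
    have "map (\<lambda>j. vs ! (b + j)) (P ! i) = map (\<lambda>j. block_value (Bs ! j)) (P ! i)"
      using block indices[OF nth_mem[OF i]] by simp
    then have "(\<Prod>j\<leftarrow>P ! i. vs ! (b + j)) = (\<Prod>j\<leftarrow>P ! i. block_value (Bs ! j))"
      by (rule arg_cong)
    then show "map ((!) vs) [c..<e] ! i = map (\<lambda>js. \<Prod>j\<leftarrow>js. block_value (Bs ! j)) P ! i"
      using i by (simp add: vs gate_product e_def comp_def)
  qed (simp add: e_def)
  have "computed_poly D = sum_list (map ((!) vs) [c..<e])"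
    by (simp add: computed_poly_def output_D flip: vs_def)
      (simp add: vs gate_output comp_def)
  then show ?thesis by (simp only: products)
qed

lemma unweighted_additions_D: "unweighted_additions D"
proof -
  have "Add_Gate ws \<notin> set ls" for ws
    using leaves[of _ _ "Add_Gate ws"] by (auto simp: ls_def ms_def)
  then show ?thesis
    by (auto simp: unweighted_additions_def gates_D)
qed

lemma num_add_gates_D: "num_add_gates D = Suc (length Bs)"
proof -
  have "i < circuit_size D \<and> is_add (gate_at D i) \<longleftrightarrow> i \<in> insert e {b..<c}" for i
  proof (cases "i < Suc e")
    case True
    then show ?thesis
    proof (cases rule: level_cases)
      case 1
      then have "\<not> is_add (gate_at D i)"
        using leaf_is_input[of i] by (cases "gate_at D i"; simp)
      with 1 show ?thesis using order by auto
    qed (use order in \<open>auto simp: size_D gate_mono gate_block gate_product gate_output\<close>)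
  qed (use order in \<open>auto simp: size_D\<close>)
  then have "num_add_gates D = card (insert e {b..<c})"
    unfolding num_add_gates_def by (metis (no_types, lifting) Collect_cong Collect_mem_eq)
  then show ?thesis using order by (simp add: c_def)
qed

lemma num_mult_gates_D: "num_mult_gates D = sum_list (map length Bs) + length P"
proof -
  have "i < circuit_size D \<and> is_mult (gate_at D i) \<longleftrightarrow> i \<in> {a..<b} \<union> {c..<e}" for i
  proof (cases "i < Suc e")
    case True
    then show ?thesis
    proof (cases rule: level_cases)
      case 1
      then have "\<not> is_mult (gate_at D i)"
        using leaf_is_input[of i] by (cases "gate_at D i"; simp)
      with 1 show ?thesis using order by auto
    qed (use order in \<open>auto simp: size_D gate_mono gate_block gate_product gate_output\<close>)
  qed (use order in \<open>auto simp: size_D\<close>)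
  then have "num_mult_gates D = card ({a..<b} \<union> {c..<e})"
    unfolding num_mult_gates_def by (metis (no_types, lifting) Collect_cong Collect_mem_eq)
  also have "\<dots> = card {a..<b} + card {c..<e}"
    by (rule card_Un_disjoint) (use order in auto)
  finally show ?thesis by (simp add: b_def e_def sum_lengths)
qed

lemma input_D:
  assumes "g \<in> set (gates D)" "is_input g"
  obtains B m where "B \<in> set Bs" "m \<in> set B" "g \<in> set m"
  using assms by (auto simp: gates_D ls_def ms_def)

lemma mult_fan_in_D:
  assumes "\<And>B m. B \<in> set Bs \<Longrightarrow> m \<in> set B \<Longrightarrow> real (length m) \<le> r"
    and "\<And>js. js \<in> set P \<Longrightarrow> real (length js) \<le> r"
  shows "mult_fan_in_le D r"
  unfolding mult_fan_in_le_def
proof (intro allI impI)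
  fix js :: "nat list" assume "Mult_Gate js \<in> set (gates D)"
  then consider "Mult_Gate js \<in> set ls" | "js \<in> set (ranges 0 (map length ms))"
    | ks where "ks \<in> set P" "js = map ((+) b) ks"
    by (auto simp: gates_D)
  then show "real (length js) \<le> r"
  proof cases
    case 1
    then show ?thesis using leaves[of _ _ "Mult_Gate js"] by (auto simp: ls_def ms_def)
  next
    case 2
    then show ?thesis using length_in_ranges[OF 2] assms(1) by (auto simp: ms_def)
  qed (use assms(2) in auto)
qed

end

section \<open>Iterated matrix products\<close>

text \<open>The factors of one summand in the expansion of a matrix product, \<open>vs\<close> being
  the interior vertices. The entry type is arbitrary because walks are taken over gates, over block
  indices and over blocks.\<close>

fun walk :: "(nat \<Rightarrow> nat \<Rightarrow> 'b) list \<Rightarrow> nat \<Rightarrow> nat list \<Rightarrow> nat \<Rightarrow> 'b list" where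
  "walk [] u vs v = []"
| "walk [m] u vs v = [m u v]"
| "walk (m # m' # ms) u vs v = m u (hd vs) # walk (m' # ms) (hd vs) (tl vs) v"

lemma length_walk [simp]: "length (walk ms u vs v) = length ms"
  by (induction ms u vs v rule: walk.induct) simp_all

lemma set_walk:
  assumes "x \<in> set (walk ms u vs v)" "u < n" "v < n" "set vs \<subseteq> {0..<n}" "length ms = Suc (length vs)"
  shows "\<exists>m\<in>set ms. \<exists>i<n. \<exists>j<n. x = m i j"
  using assms
proof (induction ms u vs v rule: walk.induct)
  case (3 m m' ms u vs v)
  then obtain w ws where vs: "vs = w # ws" by (cases vs) auto
  with 3 show ?case by auto
qed auto

fun mat_prod :: "nat \<Rightarrow> (nat \<Rightarrow> nat \<Rightarrow> 'b::comm_semiring_1) list \<Rightarrow> nat \<Rightarrow> nat \<Rightarrow> 'b" where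
  "mat_prod n [] u v = (if u = v then 1 else 0)"
| "mat_prod n (X # Xs) u v = (\<Sum>w<n. X u w * mat_prod n Xs w v)"

lemma mat_prod_singleton: "v < n \<Longrightarrow> mat_prod n [X] u v = X u v"
  by (simp add: if_distrib[of "(*) _"] cong: if_cong)

lemma mat_prod_append:
  "u < n \<Longrightarrow> mat_prod n (Xs @ Ys) u v = (\<Sum>w<n. mat_prod n Xs u w * mat_prod n Ys w v)"
proof (induction Xs arbitrary: u)
  case Nil
  then show ?case by (simp add: if_distrib[of "\<lambda>x. x * _"] cong: if_cong)
next
  case (Cons X Xs)
  have "mat_prod n ((X # Xs) @ Ys) u v =
      (\<Sum>z<n. \<Sum>w<n. X u z * mat_prod n Xs z w * mat_prod n Ys w v)"
    using Cons.IH by (simp add: sum_distrib_left mult.assoc)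
  also have "\<dots> = (\<Sum>w<n. \<Sum>z<n. X u z * mat_prod n Xs z w * mat_prod n Ys w v)"
    by (rule sum.swap)
  finally show ?case by (simp add: sum_distrib_right)
qed

text \<open>Associativity of the matrix product. It permits cutting a long product of elementary
  steps into \<open>q\<close> equal factors, which separates the lower from the upper pair of
  levels.\<close>

lemma mat_prod_concat_replicate:
  assumes "u < n"
  shows "mat_prod n (concat (replicate q Xs)) u v = mat_prod n (replicate q (mat_prod n Xs)) u v"
  using assms by (induction q arbitrary: u) (simp_all add: mat_prod_append)

lemma mat_prod_cong:
  assumes "length Xs = length Ys"
    and "\<And>i u v. i < length Xs \<Longrightarrow> u < n \<Longrightarrow> v < n \<Longrightarrow> (Xs ! i) u v = (Ys ! i) u v" and "u < n"
  shows "mat_prod n Xs u v = mat_prod n Ys u v"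
  using assms
proof (induction Xs Ys arbitrary: u rule: list_induct2)
  case (Cons X Xs Y Ys)
  have "mat_prod n Xs w v = mat_prod n Ys w v" if "w < n" for w
    by (rule Cons.IH) (use Cons.prems(1)[of "Suc _"] that in auto)
  moreover have "X u w = Y u w" if "w < n" for w
    using Cons.prems(1)[of 0 u w] Cons.prems(2) that by simp
  ultimately show ?case by simp
qed simp

text \<open>In \<open>List.n_lists\<close> the head varies fastest, so the sum over the first vertex
  arises innermost and has to be exchanged with the sum over the rest.\<close>

lemma sum_list_n_lists_Suc:
  "(\<Sum>vs\<leftarrow>List.n_lists (Suc k) [0..<n]. f vs) =
    (\<Sum>w<n. \<Sum>vs\<leftarrow>List.n_lists k [0..<n]. f (w # vs))" for f :: "nat list \<Rightarrow> 'b::comm_monoid_add"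
proof -
  have swap: "(\<Sum>vs\<leftarrow>xs. \<Sum>w\<leftarrow>[0..<n]. f (w # vs)) = (\<Sum>w<n. \<Sum>vs\<leftarrow>xs. f (w # vs))" for xs
    by (induction xs) (simp_all add: sum.distrib interv_sum_list_conv_sum_set_nat atLeast0LessThan)
  have "(\<Sum>vs\<leftarrow>List.n_lists (Suc k) [0..<n]. f vs) =
      (\<Sum>vs\<leftarrow>List.n_lists k [0..<n]. \<Sum>w\<leftarrow>[0..<n]. f (w # vs))"
  proof -
    have "sum_list (concat xss) = (\<Sum>xs\<leftarrow>xss. sum_list xs)" for xss :: "'b list list"
      by (induction xss) simp_all
    then show ?thesis by (simp add: map_concat comp_def)
  qed
  then show ?thesis by (simp only: swap)
qed

text \<open>Distributivity, one summand per choice of interior vertices. Since \<open>\<phi>\<close>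
  evaluates entries only after the walk is formed, the left side can be read as a sum of products of
  gates.\<close>

lemma sum_walks:
  assumes "ms \<noteq> []" "v < n"
  shows "(\<Sum>vs\<leftarrow>List.n_lists (length ms - 1) [0..<n]. \<Prod>x\<leftarrow>walk ms u vs v. \<phi> x) =
    mat_prod n (map (\<lambda>m u v. \<phi> (m u v)) ms) u v"
  using assms
proof (induction ms arbitrary: u)
  case (Cons m ms)
  show ?case
  proof (cases ms)
    case Nil
    then show ?thesis using Cons.prems mat_prod_singleton[of v n "\<lambda>u v. \<phi> (m u v)" u] by simp
  next
    case (Cons m' ms')
    then show ?thesis
      using Cons.IH Cons.prems
      by (simp del: List.n_lists.simps add: sum_list_n_lists_Suc sum_list_const_mult)
  qed
qed simp

lemma length_n_lists_upt [simp]: "length (List.n_lists k [0..<n]) = n ^ k"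
  by (simp add: length_n_lists)

lemma set_n_lists_upt:
  "vs \<in> set (List.n_lists k [0..<n]) \<Longrightarrow> length vs = k \<and> set vs \<subseteq> {0..<n}"
  by (auto simp: set_n_lists)

section \<open>Weakly skew circuits as iterated matrix products\<close>

text \<open>Both arguments may qualify, so one is fixed by choice. A position is chosen rather than
  a gate, because an edge is identified by its target and position.\<close>

definition closed_pos :: "('v, 'a) circuit \<Rightarrow> nat \<Rightarrow> nat" where
  "closed_pos C i = (SOME p. p < 2 \<and> connected_only_through C i p)"

definition closed_arg :: "('v, 'a) circuit \<Rightarrow> nat \<Rightarrow> nat" where
  "closed_arg C i = args C i ! closed_pos C i"

definition open_arg :: "('v, 'a) circuit \<Rightarrow> nat \<Rightarrow> nat" where
  "open_arg C i = args C i ! (1 - closed_pos C i)"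

text \<open>The total weight of the paths from \<open>x\<close> to \<open>g\<close> that use only the edges into addition gates
  (with their weights) and the edges from closed arguments (with weight 1). The guards only serve
  termination.\<close>

function coef :: "('v, 'a::comm_ring_1) circuit \<Rightarrow> nat \<Rightarrow> nat \<Rightarrow> 'a" where
  "coef C x g = (case gate_at C g of
      Add_Gate ws \<Rightarrow> (\<Sum>(a, j)\<leftarrow>ws. if j < g then a * coef C x j else 0)
    | Mult_Gate js \<Rightarrow> if closed_arg C g < g then coef C x (closed_arg C g) else 0
    | _ \<Rightarrow> if x = g then 1 else 0)"
  by pat_completeness auto
termination by (relation "measure (\<lambda>(C, x, g). g)") auto

declare coef.simps [simp del]

lemma subcircuit_refl [simp]: "b \<in> subcircuit C b"
  by (simp add: subcircuit_def)

lemma subcircuit_trans: "h \<in> subcircuit C g \<Longrightarrow> g \<in> subcircuit C b \<Longrightarrow> h \<in> subcircuit C b"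
  by (simp add: subcircuit_def)

lemma subcircuit_arg: "j \<in> set (args C i) \<Longrightarrow> i < circuit_size C \<Longrightarrow> j \<in> subcircuit C i"
  by (auto simp: subcircuit_def edges_def)

lemma subcircuit_le:
  assumes "is_circuit C" "g \<in> subcircuit C b"
  shows "g \<le> b"
proof -
  have "(g, b) \<in> (edges C)\<^sup>*" using assms by (simp add: subcircuit_def)
  then show ?thesis
    by (induction rule: rtrancl_induct)
      (use is_circuit_argsD[OF assms(1)] in \<open>force simp: edges_def\<close>)+
qed

lemma finite_subcircuit: "is_circuit C \<Longrightarrow> finite (subcircuit C b)"
  by (rule finite_subset[of _ "{..b}"]) (auto dest: subcircuit_le)

locale weakly_skew_circuit =
  fixes C :: "('v, 'a::field) circuit"
  assumes circuit: "is_circuit C" and skew: "weakly_skew C"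
begin

abbreviation "t \<equiv> circuit_size C"
abbreviation "out \<equiv> output_gate C"
abbreviation "mult i \<equiv> is_mult (gate_at C i)"
abbreviation "val i \<equiv> run gate_value (gates C) ! i"
abbreviation "deg i \<equiv> run gate_degree (gates C) ! i"
abbreviation "cl \<equiv> closed_arg C"
abbreviation "op \<equiv> open_arg C"
abbreviation "sub \<equiv> subcircuit C"

lemma out_less: "out < t"
  using circuit by (simp add: is_circuit_def)

lemma arg_less: "i < t \<Longrightarrow> j \<in> set (args C i) \<Longrightarrow> j < i"
  using is_circuit_argsD[OF circuit] .

section \<open>Closed and open arguments of one multiplication gate\<close>

context
  fixes i assumes i: "i < t" "mult i"
begin

lemma length_args: "length (args C i) = 2"
  using skew i by (simp add: weakly_skew_def)

lemma closed_pos: "closed_pos C i < 2" "connected_only_through C i (closed_pos C i)"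
proof -
  have "\<exists>p. p < 2 \<and> connected_only_through C i p"
    using skew i by (auto simp: weakly_skew_def)
  from someI_ex[OF this] show "closed_pos C i < 2" "connected_only_through C i (closed_pos C i)"
    by (simp_all add: closed_pos_def)
qed

lemma set_args: "set (args C i) = {cl i, op i}"
proof -
  obtain x y where "args C i = [x, y]" using length_args
    by (auto simp: length_Suc_conv numeral_2_eq_2)
  moreover have "closed_pos C i = 0 \<or> closed_pos C i = 1" using closed_pos by auto
  ultimately show ?thesis by (auto simp: closed_arg_def open_arg_def)
qed

lemma closed_less: "cl i < i" and open_less: "op i < i"
  using arg_less[OF i(1)] by (simp_all add: set_args)

text \<open>The position \<open>q\<close> is identified along with the gate, which later rules out
  the open edge into \<open>i\<close> as an exit.\<close>

lemma exit:
  assumes "j \<in> sub (cl i)" "k < t" "q < length (args C k)" "args C k ! q = j" "k \<notin> sub (cl i)"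
  shows "k = i" "q = closed_pos C i"
  using closed_pos(2) assms
  by (auto simp: connected_only_through_def closed_arg_def Let_def)

lemma exit': "j \<in> sub (cl i) \<Longrightarrow> k < t \<Longrightarrow> j \<in> set (args C k) \<Longrightarrow> k \<in> sub (cl i) \<or> k = i"
  using exit by (metis in_set_conv_nth)

lemma not_in_closed: "i \<notin> sub (cl i)"
  using subcircuit_le[OF circuit, of i "cl i"] closed_less by auto

text \<open>On a path from \<open>g\<close> to \<open>h\<close>, the first edge that leaves the
  closed subcircuit can only end in \<open>i\<close>.\<close>

lemma path_exit:
  assumes "g \<in> sub (cl i)" "g \<in> sub h"
  shows "h \<in> sub (cl i) \<or> i \<in> sub h"
proof -
  have "(g, h) \<in> (edges C)\<^sup>*" using assms by (simp add: subcircuit_def)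
  then show ?thesis
  proof (induction rule: rtrancl_induct)
    case base
    then show ?case using assms by simp
  next
    case (step h k)
    then have k: "k < t" "h \<in> set (args C k)" by (auto simp: edges_def)
    with step.IH exit'[of h k] show ?case
      using subcircuit_arg[OF k(2,1)] subcircuit_trans[of i C h k] by auto
  qed
qed

lemma val_mult: "val i = val (op i) * val (cl i)" and deg_mult: "deg i = deg (op i) + deg (cl i)"
proof -
  obtain x y where xy: "args C i = [x, y]" using length_args
    by (auto simp: length_Suc_conv numeral_2_eq_2)
  then have g: "gate_at C i = Mult_Gate [x, y]"
    using i by (cases "gate_at C i") (auto simp: args_def)
  have "closed_pos C i = 0 \<or> closed_pos C i = 1" using closed_pos by auto
  then show "val i = val (op i) * val (cl i)" "deg i = deg (op i) + deg (cl i)"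
    using run_gate_value[OF circuit i(1)] run_gate_degree[OF circuit i(1)] g xy
    by (auto simp: closed_arg_def open_arg_def)
qed

text \<open>By \<open>path_exit\<close> a common gate would put either \<open>op i\<close> into the
  closed subcircuit, where its edge into \<open>i\<close> would be a second exit, or
  \<open>i\<close> below its own argument.\<close>

lemma disjoint_args: "sub (cl i) \<inter> sub (op i) = {}"
proof -
  have len: "length (args C i) = 2" by (rule length_args)
  have "op i \<notin> sub (cl i)"
  proof
    assume "op i \<in> sub (cl i)"
    from exit(2)[OF this i(1) _ _ not_in_closed, of "1 - closed_pos C i"]
    have "1 - closed_pos C i = closed_pos C i" by (simp add: open_arg_def len)
    with closed_pos(1) show False by presburger
  qed
  moreover have "i \<notin> sub (op i)"
    using subcircuit_le[OF circuit, of i "op i"] open_less by auto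
  ultimately show ?thesis using path_exit by blast
qed

end

section \<open>Positivity and size bound of formal degrees\<close>

lemma deg_add_ge:
  assumes "i < t" "gate_at C i = Add_Gate ws" "(a, j) \<in> set ws"
  shows "deg j \<le> deg i"
proof -
  have "deg j \<le> Max ((\<lambda>(a, j). deg j) ` set ws)"
    by (rule Max_ge) (use assms in force)+
  then show ?thesis using run_gate_degree[OF circuit assms(1)] assms(2) by simp
qed

lemma deg_pos: "i < t \<Longrightarrow> deg i \<ge> 1"
proof (induction i rule: less_induct)
  case (less i)
  show ?case
  proof (cases "gate_at C i")
    case (Add_Gate ws)
    have "args C i \<noteq> []" using circuit less.prems Add_Gate by (simp add: is_circuit_def)
    then obtain a j where aj: "(a, j) \<in> set ws"
      using Add_Gate by (cases ws) (auto simp: args_def)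
    have "deg j \<ge> 1"
      using less arg_less[OF less.prems, of j] aj Add_Gate by (force simp: args_def)
    then show ?thesis using deg_add_ge[OF less.prems Add_Gate aj] by simp
  next
    case (Mult_Gate js)
    then have "mult i" by simp
    with less deg_mult[of i] closed_less[of i] show ?thesis by force
  qed (use run_gate_degree[OF circuit less.prems] in simp_all)
qed

text \<open>At a multiplication the two argument subcircuits are disjoint, so their cardinalities
  add up just as the degrees do; at an addition the largest argument decides.\<close>

lemma deg_le_card: "i < t \<Longrightarrow> deg i \<le> card (sub i)"
proof (induction i rule: less_induct)
  case (less i)
  have fin: "finite (sub h)" for h by (rule finite_subcircuit[OF circuit])
  have pos: "card (sub i) \<ge> 1"
    using fin[of i] subcircuit_refl[of i C] by (metis Suc_leI card_gt_0_iff empty_iff One_nat_def)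
  have mono: "sub j \<subseteq> sub i" if "j \<in> set (args C i)" for j
    using subcircuit_arg[OF that less.prems] subcircuit_trans by blast
  show ?case
  proof (cases "gate_at C i")
    case (Add_Gate ws)
    have ne: "ws \<noteq> []" using circuit less.prems Add_Gate by (auto simp: is_circuit_def args_def)
    have "deg j \<le> card (sub i)" if "(a, j) \<in> set ws" for a j
    proof -
      have j: "j \<in> set (args C i)" using that Add_Gate by (force simp: args_def)
      have "deg j \<le> card (sub j)" using less arg_less[OF less.prems j] by simp
      also have "\<dots> \<le> card (sub i)" by (rule card_mono[OF fin mono[OF j]])
      finally show ?thesis .
    qed
    then show ?thesis
      using run_gate_degree[OF circuit less.prems] Add_Gate ne by (auto simp: Max_le_iff)
  next
    case (Mult_Gate js)
    then have m: "mult i" by simp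
    have "deg i \<le> card (sub (op i)) + card (sub (cl i))"
      using less.IH less.prems deg_mult[OF less.prems m] closed_less[OF less.prems m]
        open_less[OF less.prems m] by (simp add: add_mono)
    also have "\<dots> = card (sub (op i) \<union> sub (cl i))"
      using disjoint_args[OF less.prems m] by (intro card_Un_disjoint[symmetric] fin) auto
    also have "\<dots> \<le> card (sub i)"
      using mono set_args[OF less.prems m] by (intro card_mono fin) auto
    finally show ?thesis .
  qed (use run_gate_degree[OF circuit less.prems] pos in simp_all)
qed

lemma formal_degree_le_size: "formal_degree C \<le> t"
proof -
  have "card (sub out) \<le> card {..out}"
    by (rule card_mono) (auto dest: subcircuit_le[OF circuit])
  then show ?thesis
    using deg_le_card[OF out_less] out_less by (simp add: formal_degree_def)
qed

section \<open>Nesting of closed subcircuits\<close>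

text \<open>The bound \<open>i \<le> out\<close> drops multiplications beyond the output gate, so
  that nothing encloses the output itself.\<close>

definition enclosing :: "nat \<Rightarrow> nat set" where
  "enclosing g = {i. i \<le> out \<and> mult i \<and> g \<in> sub (cl i)}"

lemma enclosingD:
  assumes "i \<in> enclosing g"
  shows "i \<le> out" "i < t" "mult i" "g \<in> sub (cl i)"
  using assms out_less by (auto simp: enclosing_def)

lemma enclosing_greater: "i \<in> enclosing g \<Longrightarrow> g < i"
  using subcircuit_le[OF circuit, of g "cl i"] closed_less[of i] out_less
  by (auto simp: enclosing_def)

lemma finite_enclosing [simp]: "finite (enclosing g)"
  by (rule finite_subset[of _ "{..out}"]) (auto simp: enclosing_def)

lemma enclosing_out: "enclosing out = {}"
  using enclosing_greater[of _ out] by (force simp: enclosing_def)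

lemma enclosing_mono:
  "j \<in> set (args C k) \<Longrightarrow> k < t \<Longrightarrow> enclosing k \<subseteq> enclosing j"
  using subcircuit_arg[of j C k] subcircuit_trans by (auto simp: enclosing_def)

text \<open>The only edge out of a closed subcircuit ends in its multiplication gate, so an edge
  into any other gate crosses no boundary.\<close>

lemma enclosing_add:
  assumes "j \<in> set (args C k)" "k < t" "\<not> mult k"
  shows "enclosing j = enclosing k"
proof
  show "enclosing j \<subseteq> enclosing k"
  proof
    fix i assume i: "i \<in> enclosing j"
    note iD = enclosingD[OF i]
    from exit'[OF iD(2,3,4) assms(2,1)] iD assms(3) show "i \<in> enclosing k"
      by (auto simp: enclosing_def)
  qed
qed (use enclosing_mono assms in blast)

text \<open>The edge from the open argument has the same target as the exit of the closed subcircuit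
  of \<open>i\<close> but the other position, so it crosses no boundary either.\<close>

lemma enclosing_open:
  assumes "i < t" "mult i"
  shows "enclosing (op i) = enclosing i"
proof
  have len: "length (args C i) = 2" by (rule length_args[OF assms])
  show "enclosing (op i) \<subseteq> enclosing i"
  proof
    fix k assume k: "k \<in> enclosing (op i)"
    then have k': "k < t" "mult k" "op i \<in> sub (cl k)" using out_less by (auto simp: enclosing_def)
    have "i \<in> sub (cl k)"
    proof (rule ccontr)
      assume n: "i \<notin> sub (cl k)"
      from exit[OF k'(1,2,3) assms(1) _ _ n, of "1 - closed_pos C i"] closed_pos(1)[OF assms]
      have "k = i" "1 - closed_pos C i = closed_pos C k"
        by (auto simp: open_arg_def len)
      with closed_pos(1)[OF assms] show False by presburger
    qed
    with k show "k \<in> enclosing i" by (auto simp: enclosing_def)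
  qed
qed (use enclosing_mono[of "op i" i] set_args assms in auto)

text \<open>The edge from the closed argument crosses exactly one boundary, its own.\<close>

lemma enclosing_closed:
  assumes "i \<le> out" "mult i"
  shows "enclosing (cl i) = insert i (enclosing i)"
proof
  have "i < t" using assms out_less by simp
  then have cl: "cl i \<in> set (args C i)" using set_args assms by simp
  show "enclosing (cl i) \<subseteq> insert i (enclosing i)"
  proof
    fix k assume k: "k \<in> enclosing (cl i)"
    note kD = enclosingD[OF k]
    from exit'[OF kD(2,3,4) \<open>i < t\<close> cl] kD show "k \<in> insert i (enclosing i)"
      by (auto simp: enclosing_def)
  qed
  show "insert i (enclosing i) \<subseteq> enclosing (cl i)"
    using enclosing_mono[OF cl \<open>i < t\<close>] assms by (auto simp: enclosing_def)
qed

text \<open>Closed subcircuits with a common gate are nested. By \<open>path_exit\<close> either the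
  smaller gate \<open>i\<close> lies in the closed subcircuit of \<open>k\<close>, or
  \<open>cl k\<close> lies in that of \<open>i\<close>, which would force
  \<open>k < i\<close>.\<close>

lemma enclosing_Min:
  assumes "enclosing g \<noteq> {}"
  defines "i \<equiv> Min (enclosing g)"
  shows "enclosing g = insert i (enclosing i)" "i \<le> out" "mult i" "i \<notin> enclosing i"
proof -
  have "i \<in> enclosing g" unfolding i_def by (rule Min_in) (use assms in auto)
  then have i: "i \<le> out" "mult i" and g: "g \<in> sub (cl i)" by (auto simp: enclosing_def)
  then show "i \<le> out" "mult i" by simp_all
  have it: "i < t" using i out_less by simp
  show "i \<notin> enclosing i" using enclosing_greater by blast
  have "k \<in> enclosing i" if k: "k \<in> enclosing g" "k \<noteq> i" for k
  proof -
    have "i \<le> k" unfolding i_def by (rule Min_le) (use k in simp_all)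
    with k(2) have "i < k" by simp
    have k': "k \<le> out" "k < t" "mult k" "g \<in> sub (cl k)"
      using k out_less by (auto simp: enclosing_def)
    have "cl k \<notin> sub (cl i)"
    proof
      assume "cl k \<in> sub (cl i)"
      then have "k \<in> sub (cl i)"
        using exit'[OF it i(2), of "cl k" k] k' k(2) set_args[of k] by auto
      then have "k \<le> cl i" using subcircuit_le[OF circuit] by blast
      with \<open>i < k\<close> closed_less[OF it i(2)] show False by simp
    qed
    then have "i \<in> sub (cl k)" using path_exit[OF it i(2) g k'(4)] by simp
    with k' show ?thesis by (simp add: enclosing_def)
  qed
  moreover have "enclosing i \<subseteq> enclosing g"
  proof
    fix k assume k: "k \<in> enclosing i"
    then have "k \<in> enclosing (cl i)" using enclosing_closed[OF i] by simp
    then have "cl i \<in> sub (cl k)" by (rule enclosingD)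
    with g have "g \<in> sub (cl k)" by (rule subcircuit_trans)
    then show "k \<in> enclosing g" using enclosingD(1,3)[OF k] by (simp add: enclosing_def)
  qed
  ultimately show "enclosing g = insert i (enclosing i)"
    using \<open>i \<in> enclosing g\<close> by blast
qed

section \<open>Accumulated values and degrees\<close>

text \<open>The default \<open>t\<close> is one past the last gate and plays the global source.
  Otherwise paths continue from the open argument of the innermost enclosing multiplication, which
  by nesting is the smallest one.\<close>

definition origin :: "nat \<Rightarrow> nat" where
  "origin g = (if enclosing g = {} then t else op (Min (enclosing g)))"

text \<open>The value of a gate accumulated along the paths from the global source: inside the closed
  argument of a multiplication gate, paths start at the other argument of that gate.\<close>

definition gval :: "nat \<Rightarrow> ('v, 'a) mpoly" where
  "gval g = val g * (\<Prod>i\<in>enclosing g. val (op i))"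

definition gdeg :: "nat \<Rightarrow> nat" where
  "gdeg g = deg g + (\<Sum>i\<in>enclosing g. deg (op i))"

lemma gval_out: "gval out = computed_poly C"
  by (simp add: gval_def enclosing_out computed_poly_def)

lemma gdeg_out: "gdeg out = formal_degree C"
  by (simp add: gdeg_def enclosing_out formal_degree_def)

lemma gdeg_pos: "i < t \<Longrightarrow> gdeg i \<ge> 1"
  using deg_pos[of i] by (simp add: gdeg_def)

text \<open>The factor of \<open>op i\<close> contained in the value of \<open>i\<close> reappears
  in the accumulated product at \<open>cl i\<close>, whose set of enclosing gates grows by exactly
  \<open>i\<close>.\<close>

lemma gval_mult:
  assumes "i \<le> out" "mult i"
  shows "gval i = gval (cl i)" "gdeg i = gdeg (cl i)"
proof -
  have "i < t" "i \<notin> enclosing i" using assms out_less enclosing_greater by auto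
  then show "gval i = gval (cl i)" "gdeg i = gdeg (cl i)"
    using assms
    by (simp_all add: gval_def gdeg_def enclosing_closed val_mult deg_mult mult_ac)
qed

text \<open>All arguments have the same enclosing gates as \<open>i\<close>, so the accumulated
  factor is common and linearity survives.\<close>

lemma gval_add:
  assumes "i < t" "gate_at C i = Add_Gate ws"
  shows "gval i = (\<Sum>(a, j)\<leftarrow>ws. mp_const a * gval j)"
proof -
  have e: "enclosing j = enclosing i" if "(a, j) \<in> set ws" for a j
    by (rule enclosing_add) (use assms that in \<open>force simp: args_def\<close>)+
  have "gval i = (\<Sum>(a, j)\<leftarrow>ws. mp_const a * val j) * (\<Prod>k\<in>enclosing i. val (op k))"
    using run_gate_value[OF circuit assms(1)] assms(2) by (simp add: gval_def)
  also have "\<dots> = (\<Sum>(a, j)\<leftarrow>ws. mp_const a * (val j * (\<Prod>k\<in>enclosing i. val (op k))))"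
    by (simp add: sum_list_mult_const[symmetric] case_prod_unfold mult.assoc)
  also have "\<dots> = (\<Sum>(a, j)\<leftarrow>ws. mp_const a * gval j)"
    by (rule arg_cong[of _ _ sum_list], rule map_cong) (auto simp: gval_def e)
  finally show ?thesis .
qed

lemma gdeg_add:
  assumes "i < t" "gate_at C i = Add_Gate ws" "(a, j) \<in> set ws"
  shows "gdeg j \<le> gdeg i"
proof -
  have "enclosing j = enclosing i"
    by (rule enclosing_add) (use assms in \<open>force simp: args_def\<close>)+
  with deg_add_ge[OF assms] show ?thesis by (simp add: gdeg_def)
qed

lemma origin_less:
  assumes "enclosing g \<noteq> {}"
  shows "origin g < out"
proof -
  note M = enclosing_Min(2,3)[OF assms]
  have "op (Min (enclosing g)) < Min (enclosing g)"
    by (rule open_less) (use M out_less in \<open>linarith, simp\<close>)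
  also note M(1)
  finally show ?thesis using assms by (simp add: origin_def)
qed

text \<open>The open argument of the innermost enclosing gate is itself enclosed by exactly the
  remaining ones, so all factors besides that of \<open>g\<close> form the accumulated value at the
  origin.\<close>

lemma gval_enclosed:
  assumes "enclosing g \<noteq> {}"
  shows "gval g = val g * gval (origin g)" "gdeg g = deg g + gdeg (origin g)"
proof -
  let ?i = "Min (enclosing g)"
  note M = enclosing_Min[OF assms]
  have "?i < t" using M(2) out_less by simp
  then have op: "enclosing (op ?i) = enclosing ?i" using enclosing_open M(3) by simp
  have "(\<Prod>i\<in>enclosing g. val (op i)) = val (op ?i) * (\<Prod>i\<in>enclosing ?i. val (op i))"
    using M(4) by (subst M(1)) simp
  then show "gval g = val g * gval (origin g)"
    using assms by (simp add: gval_def origin_def op)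
  have "(\<Sum>i\<in>enclosing g. deg (op i)) = deg (op ?i) + (\<Sum>i\<in>enclosing ?i. deg (op i))"
    using M(4) by (subst M(1)) simp
  then show "gdeg g = deg g + gdeg (origin g)"
    using assms by (simp add: gdeg_def origin_def op)
qed

section \<open>Elimination of the inner gates from the linear system\<close>

definition inputs :: "nat set" where
  "inputs = {x. x \<le> out \<and> is_input (gate_at C x)}"

lemma finite_inputs [simp]: "finite inputs"
  by (simp add: inputs_def)

lemma coef_input: "is_input (gate_at C g) \<Longrightarrow> coef C x g = (if x = g then 1 else 0)"
  by (subst coef.simps) (cases "gate_at C g"; simp)

lemma coef_add:
  assumes "g < t" "gate_at C g = Add_Gate ws"
  shows "coef C x g = (\<Sum>(a, j)\<leftarrow>ws. a * coef C x j)"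
proof -
  have "coef C x g = (\<Sum>(a, j)\<leftarrow>ws. if j < g then a * coef C x j else 0)"
    using assms by (subst coef.simps) simp
  also have "\<dots> = (\<Sum>(a, j)\<leftarrow>ws. a * coef C x j)"
    by (rule arg_cong[of _ _ sum_list], rule map_cong)
      (use arg_less[OF assms(1)] assms(2) in \<open>force simp: args_def\<close>)+
  finally show ?thesis .
qed

lemma coef_mult:
  assumes "g < t" "mult g"
  shows "coef C x g = coef C x (cl g)"
  using assms closed_less[OF assms] by (subst coef.simps) (cases "gate_at C g"; simp)

text \<open>\<open>coef\<close> and \<open>gval\<close> obey the same recursion at additions and
  multiplications, and at an input \<open>coef\<close> selects that input alone.\<close>

lemma gval_coef:
  "g \<le> out \<Longrightarrow> gval g = (\<Sum>x\<in>inputs. mp_const (coef C x g) * gval x)"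
proof (induction g rule: less_induct)
  case (less g)
  then have g: "g < t" using out_less by simp
  consider "is_input (gate_at C g)" | ws where "gate_at C g = Add_Gate ws" | "mult g"
    by (cases "gate_at C g") auto
  then show ?case
  proof cases
    case 1
    then have "(\<Sum>x\<in>inputs. mp_const (coef C x g) * gval x) =
        (\<Sum>x\<in>inputs. if x = g then gval x else 0)"
      by (intro sum.cong) (auto simp: coef_input)
    also have "\<dots> = gval g" using 1 less.prems by (simp add: inputs_def)
    finally show ?thesis by simp
  next
    case 2
    have IH: "gval j = (\<Sum>x\<in>inputs. mp_const (coef C x j) * gval x)" if "(a, j) \<in> set ws" for a j
    proof -
      have "j < g" using arg_less[OF g, of j] that 2 by (force simp: args_def)
      then show ?thesis using less by simp
    qed
    have swap: "(\<Sum>(a, j)\<leftarrow>xs. \<Sum>x\<in>inputs. f a j x) = (\<Sum>x\<in>inputs. \<Sum>(a, j)\<leftarrow>xs. f a j x)"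
      for xs :: "('a \<times> nat) list" and f :: "'a \<Rightarrow> nat \<Rightarrow> nat \<Rightarrow> ('v, 'a) mpoly"
      by (induction xs) (auto simp: sum.distrib)
    have "gval g = (\<Sum>(a, j)\<leftarrow>ws. mp_const a * gval j)" by (rule gval_add[OF g 2])
    also have "\<dots> = (\<Sum>(a, j)\<leftarrow>ws. \<Sum>x\<in>inputs. mp_const (a * coef C x j) * gval x)"
      by (rule arg_cong[of _ _ sum_list], rule map_cong)
        (use IH in \<open>auto simp: sum_distrib_left mp_const_mult mult.assoc\<close>)
    also have "\<dots> = (\<Sum>x\<in>inputs. \<Sum>(a, j)\<leftarrow>ws. mp_const (a * coef C x j) * gval x)"
      by (rule swap)
    also have "\<dots> = (\<Sum>x\<in>inputs. mp_const (coef C x g) * gval x)"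
      by (simp add: coef_add[OF g 2] mp_const_sum_list case_prod_unfold sum_list_mult_const)
    finally show ?thesis .
  next
    case 3
    then show ?thesis
      using less.IH[of "cl g"] closed_less[OF g 3] less.prems
      by (simp add: gval_mult coef_mult[OF g 3])
  qed
qed

text \<open>A nonzero coefficient at \<open>g\<close> is inherited from an argument with nonzero
  coefficient, and toward \<open>g\<close> the accumulated degree never decreases.\<close>

lemma gdeg_coef:
  "g < t \<Longrightarrow> g \<le> out \<Longrightarrow> coef C x g \<noteq> 0 \<Longrightarrow> gdeg x \<le> gdeg g"
proof (induction g rule: less_induct)
  case (less g)
  note g = less.prems(1)
  consider "is_input (gate_at C g)" | ws where "gate_at C g = Add_Gate ws" | "mult g"
    by (cases "gate_at C g") auto
  then show ?case
  proof cases
    case 1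
    then show ?thesis using less.prems(3) by (simp add: coef_input split: if_splits)
  next
    case 2
    have "\<exists>(a, j)\<in>set ws. coef C x j \<noteq> 0"
    proof (rule ccontr)
      assume "\<not> ?thesis"
      then have "map (\<lambda>(a, j). a * coef C x j) ws = map (\<lambda>_. 0) ws"
        by (intro map_cong) auto
      then have "coef C x g = 0" by (simp only: coef_add[OF g 2] sum_list_0)
      with less.prems show False by simp
    qed
    then obtain a j where j: "(a, j) \<in> set ws" "coef C x j \<noteq> 0" by auto
    have "j < g" using arg_less[OF g, of j] j 2 by (force simp: args_def)
    with less j have "gdeg x \<le> gdeg j" by simp
    also have "\<dots> \<le> gdeg g" by (rule gdeg_add[OF g 2 j(1)])
    finally show ?thesis .
  next
    case 3
    then show ?thesis
      using less closed_less[OF g 3] by (simp add: gval_mult coef_mult)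
  qed
qed

text \<open>An addition at most doubles the bound of the gates before it and a multiplication copies
  a coefficient, so the gate number can serve as exponent.\<close>

lemma coef_bound:
  assumes cf: "constant_free C" and oa: "ordinary_additions C" and "g < t"
  shows "\<exists>n::int. coef C x g = of_int n \<and> \<bar>n\<bar> \<le> 2 ^ g"
  using \<open>g < t\<close>
proof (induction g rule: less_induct)
  case (less g)
  note g = less.prems
  have pow: "(2::int) ^ j \<le> 2 ^ h" if "j \<le> h" for j h :: nat using that by simp
  consider "is_input (gate_at C g)" | ws where "gate_at C g = Add_Gate ws" | "mult g"
    by (cases "gate_at C g") auto
  then show ?case
  proof cases
    case 1
    then show ?thesis
      by (intro exI[of _ "if x = g then 1 else 0"]) (simp add: coef_input)
  next
    case 2
    have "Add_Gate ws \<in> set (gates C)" using 2 g by (metis circuit_size_def nth_mem)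
    with oa have "map fst ws = [1, 1] \<or> map fst ws = [1, -1]"
      by (auto simp: ordinary_additions_def)
    \<comment> \<open>\<open>s\<close> is the sign of the second weight as an integer; it treats sum
      and difference at once.\<close>
    then obtain s :: int and i j where s: "s = 1 \<or> s = -1" and ws: "ws = [(1, i), (of_int s, j)]"
      by (auto simp: map_eq_Cons_conv) (metis of_int_1 of_int_minus)+
    have ij: "i < g" "j < g" using arg_less[OF g] 2 ws by (auto simp: args_def)
    with less.IH g obtain m n where m: "coef C x i = of_int m" "\<bar>m\<bar> \<le> 2 ^ i"
      and n: "coef C x j = of_int n" "\<bar>n\<bar> \<le> 2 ^ j" by (meson less_trans)
    \<comment> \<open>Both arguments lie at or before \<open>h\<close>, so each coefficient is at
      most \<open>2 ^ h\<close>, half of the target.\<close>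
    obtain h where h: "g = Suc h" using ij by (cases g) auto
    have "\<bar>m + s * n\<bar> \<le> \<bar>m\<bar> + \<bar>n\<bar>" using s by auto
    also have "\<dots> \<le> 2 ^ h + 2 ^ h" using m n pow[of i h] pow[of j h] ij h by linarith
    finally have "\<bar>m + s * n\<bar> \<le> 2 ^ g" by (simp add: h)
    moreover have "coef C x g = of_int (m + s * n)"
      by (simp add: coef_add[OF g 2] ws m n)
    ultimately show ?thesis by blast
  next
    case 3
    have "cl g < g" by (rule closed_less[OF g 3])
    with less.IH[of "cl g"] g obtain n :: int where "coef C x (cl g) = of_int n" "\<bar>n\<bar> \<le> 2 ^ cl g"
      by auto
    moreover have "(2::int) ^ cl g \<le> 2 ^ g" using \<open>cl g < g\<close> by (intro pow) simp
    ultimately show ?thesis unfolding coef_mult[OF g 3] by (meson order_trans)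
  qed
qed

section \<open>Layered paths to the source\<close>

text \<open>Vertex \<open>t\<close> is the source, with a loop of weight 1 so that short paths can be padded.\<close>

definition const_step :: "nat \<Rightarrow> nat \<Rightarrow> ('v, 'a) gate" where
  "const_step g x = Const_Gate (if g = t then (if x = t then 1 else 0)
     else if x \<in> inputs then coef C x g else 0)"

text \<open>A path through the input \<open>x\<close> goes on at its origin. The entries are input
  gates, not polynomials, so that a walk is directly a list of leaves.\<close>

definition input_step :: "nat \<Rightarrow> nat \<Rightarrow> ('v, 'a) gate" where
  "input_step x h = (if x = t then Const_Gate (if h = t then 1 else 0)
     else if x \<in> inputs \<and> h = origin x then gate_at C x else Const_Gate 0)"

definition steps :: "nat \<Rightarrow> (nat \<Rightarrow> nat \<Rightarrow> ('v, 'a) gate) list" where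
  "steps e = concat (replicate e [const_step, input_step])"

definition paths :: "nat \<Rightarrow> nat \<Rightarrow> ('v, 'a) mpoly" where
  "paths N g = mat_prod (Suc t) (map (\<lambda>m u v. leaf_value (m u v)) (steps N)) g t"

lemma inputs_less: "x \<in> inputs \<Longrightarrow> x < t"
  using out_less by (simp add: inputs_def)

lemma paths_Suc: "paths (Suc N) g =
    (\<Sum>x<Suc t. leaf_value (const_step g x) *
      (\<Sum>h<Suc t. leaf_value (input_step x h) * paths N h))"
  by (simp add: paths_def steps_def del: sum.lessThan_Suc)

text \<open>The loop at the source lets a path that meets fewer than \<open>N\<close> inputs count
  in \<open>paths N\<close>.\<close>

lemma paths_source: "paths N t = 1"
proof (induction N)
  case 0
  show ?case by (simp add: paths_def steps_def)
next
  case (Suc N)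
  have "paths (Suc N) t = (\<Sum>x<Suc t. if x = t then \<Sum>h<Suc t. if h = t then paths N h else 0 else 0)"
    unfolding paths_Suc
    by (intro sum.cong refl) (auto simp: const_step_def input_step_def intro!: sum.cong)
  also have "\<dots> = 1" by (simp add: Suc)
  finally show ?case .
qed

lemma paths_Suc_gate:
  assumes "g < t"
  shows "paths (Suc N) g = (\<Sum>x\<in>inputs. mp_const (coef C x g) * (val x * paths N (origin x)))"
proof -
  have inner: "(\<Sum>h<Suc t. leaf_value (input_step x h) * paths N h) = val x * paths N (origin x)"
    if x: "x \<in> inputs" for x
  proof -
    have "origin x < Suc t"
      using origin_less[of x] out_less by (cases "enclosing x = {}") (auto simp: origin_def)
    moreover have "leaf_value (gate_at C x) = val x"
      using run_gate_value[OF circuit inputs_less[OF x]] x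
      by (cases "gate_at C x") (auto simp: inputs_def)
    moreover have "(\<Sum>h<Suc t. leaf_value (input_step x h) * paths N h) =
        (\<Sum>h<Suc t. if h = origin x then leaf_value (gate_at C x) * paths N h else 0)"
      by (intro sum.cong refl) (use x inputs_less[OF x] in \<open>auto simp: input_step_def\<close>)
    ultimately show ?thesis by (simp del: sum.lessThan_Suc)
  qed
  have "paths (Suc N) g = (\<Sum>x<Suc t. if x \<in> inputs then
      mp_const (coef C x g) * (val x * paths N (origin x)) else 0)"
    unfolding paths_Suc using assms
    by (intro sum.cong refl) (auto simp: const_step_def inner simp del: sum.lessThan_Suc)
  also have "\<dots> = (\<Sum>x\<in>{..<Suc t} \<inter> inputs. mp_const (coef C x g) * (val x * paths N (origin x)))"
    by (rule sum.inter_restrict[symmetric]) simp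
  also have "{..<Suc t} \<inter> inputs = inputs" using inputs_less by force
  finally show ?thesis .
qed

text \<open>Each input on a path uses up at least one unit of accumulated degree, so
  \<open>N\<close> rounds suffice to reach the source. For \<open>N = 0\<close> the claim is vacuous
  by \<open>gdeg_pos\<close>.\<close>

lemma paths_eq_gval: "g \<le> out \<Longrightarrow> gdeg g \<le> N \<Longrightarrow> paths N g = gval g"
proof (induction N arbitrary: g)
  case 0
  then show ?case using gdeg_pos[of g] out_less by simp
next
  case (Suc N)
  then have g: "g < t" using out_less by simp
  have "mp_const (coef C x g) * (val x * paths N (origin x)) = mp_const (coef C x g) * gval x"
    if x: "x \<in> inputs" for x
  proof (cases "coef C x g = 0")
    \<comment> \<open>The degree of \<open>x\<close> is under control only for a nonzero
      coefficient; otherwise both sides vanish.\<close>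
    case False
    show ?thesis
    proof (cases "enclosing x = {}")
      case True
      then show ?thesis by (simp add: origin_def gval_def paths_source)
    next
      case nonempty: False
      have "gdeg x \<le> Suc N" using gdeg_coef[OF g Suc.prems(1) False] Suc.prems by simp
      then have "gdeg (origin x) \<le> N"
        using gval_enclosed(2)[OF nonempty] deg_pos[OF inputs_less[OF x]] by simp
      then have "paths N (origin x) = gval (origin x)"
        using Suc.IH origin_less[OF nonempty] by simp
      then show ?thesis using gval_enclosed(1)[OF nonempty] by simp
    qed
  qed simp
  then show ?case
    unfolding paths_Suc_gate[OF g] gval_coef[OF Suc.prems(1)] by (rule sum.cong[OF refl])
qed

lemma computed_poly_eq_mat_prod:
  assumes "formal_degree C \<le> e * q"
  shows "computed_poly C = mat_prod (Suc t)
    (replicate q (mat_prod (Suc t) (map (\<lambda>m u v. leaf_value (m u v)) (steps e)))) out t"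
proof -
  have "concat (replicate (q * e) [x, y]) = concat (replicate q (concat (replicate e [x, y])))"
    for x y :: "nat \<Rightarrow> nat \<Rightarrow> ('v, 'a) gate"
    by (induction q) (simp_all add: replicate_add)
  then have "steps (e * q) = concat (replicate q (steps e))"
    by (simp add: steps_def mult.commute)
  moreover have "computed_poly C = paths (e * q) out"
    using paths_eq_gval[of out "e * q"] assms gdeg_out gval_out by simp
  ultimately show ?thesis
    using out_less by (simp add: paths_def map_concat mat_prod_concat_replicate)
qed

section \<open>Sums of products read off from walks\<close>

lemma length_steps [simp]: "length (steps e) = 2 * e"
  by (simp add: steps_def length_concat sum_list_replicate)

text \<open>The expansion of one entry of \<open>(K L) ^ e\<close> into monomials of
  \<open>2 * e\<close> leaves. Monomials that vanish are kept, so every entry has the same number of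
  them.\<close>

definition block :: "nat \<Rightarrow> nat \<Rightarrow> nat \<Rightarrow> ('v, 'a) gate list list" where
  "block e u v = map (\<lambda>vs. walk (steps e) u vs v) (List.n_lists (2 * e - 1) [0..<Suc t])"

lemma length_block [simp]: "length (block e u v) = Suc t ^ (2 * e - 1)"
  by (simp add: block_def length_n_lists)

lemma block_value_block:
  assumes "e > 0" "v < Suc t"
  shows "block_value (block e u v) =
    mat_prod (Suc t) (map (\<lambda>m u v. leaf_value (m u v)) (steps e)) u v"
proof -
  have "steps e \<noteq> []" using assms(1) by (cases e) (simp_all add: steps_def)
  from sum_walks[OF this assms(2), of leaf_value u] show ?thesis
    by (simp add: block_value_def block_def comp_def del: upt_Suc)
qed

lemma block_leaf:
  assumes "m \<in> set (block e u v)" "g \<in> set m" "e > 0" "u < Suc t" "v < Suc t"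
  obtains i j where "i < Suc t" "j < Suc t" "g = const_step i j \<or> g = input_step i j"
proof -
  obtain vs where vs: "length vs = 2 * e - 1" "set vs \<subseteq> {0..<Suc t}" "m = walk (steps e) u vs v"
    using assms(1) set_n_lists_upt[of _ "2 * e - 1" "Suc t"] unfolding block_def by auto
  have "length (steps e) = Suc (length vs)" using vs(1) assms(3) by simp
  with set_walk[of g "steps e" u vs v "Suc t"] assms vs
  obtain X i j where "X \<in> set (steps e)" "i < Suc t" "j < Suc t" "g = X i j" by blast
  moreover have "set (steps e) \<subseteq> {const_step, input_step}"
    by (auto simp: steps_def)
  ultimately show thesis using that by blast
qed

lemma step_is_input: "is_input (const_step i j)" "is_input (input_step i j)"
  by (auto simp: const_step_def input_step_def inputs_def)

lemma step_from: "const_step i j \<in> set (gates C) \<or> (\<exists>c. const_step i j = Const_Gate c)"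
  "input_step i j \<in> set (gates C) \<or> (\<exists>c. input_step i j = Const_Gate c)"
  using inputs_less by (auto simp: const_step_def input_step_def circuit_size_def)

text \<open>Only the \<open>coef\<close> entries can leave the range -1, 0, 1: constants labelling
  inputs of \<open>C\<close> lie in it by constant-freeness.\<close>

lemma step_bound:
  assumes "constant_free C" "ordinary_additions C" "i < Suc t"
    and "Const_Gate c = const_step i j \<or> Const_Gate c = input_step i j"
  shows "\<exists>n::int. c = of_int n \<and> \<bar>n\<bar> \<le> 2 ^ t"
proof -
  have unit: ?thesis if "c \<in> {-1, 0, 1}"
  proof -
    have "c = of_int (-1) \<or> c = of_int 0 \<or> c = of_int 1" using that by auto
    moreover have "\<bar>-1\<bar> \<le> (2::int) ^ t" "\<bar>0\<bar> \<le> (2::int) ^ t" "\<bar>1\<bar> \<le> (2::int) ^ t" by simp_all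
    ultimately show ?thesis by blast
  qed
  from assms(4) show ?thesis
  proof
    assume "Const_Gate c = const_step i j"
    then have "c \<in> {-1, 0, 1} \<or> i < t \<and> c = coef C j i"
      using assms(3) by (auto simp: const_step_def split: if_splits)
    moreover have ?thesis if i: "i < t" "c = coef C j i"
    proof -
      obtain n :: int where n: "c = of_int n" "\<bar>n\<bar> \<le> 2 ^ i"
        using coef_bound[OF assms(1,2) i(1), of j] i(2) by blast
      have "(2::int) ^ i \<le> 2 ^ t" using i by (intro power_increasing) auto
      with n have "\<bar>n\<bar> \<le> 2 ^ t" by linarith
      with n(1) show ?thesis by blast
    qed
    ultimately show ?thesis using unit by blast
  next
    assume c: "Const_Gate c = input_step i j"
    have "c \<in> {-1, 0, 1}"
    proof (cases "i \<in> inputs \<and> i \<noteq> t \<and> j = origin i")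
      case True
      then have "gate_at C i = Const_Gate c" using c by (simp add: input_step_def)
      then have "Const_Gate c \<in> set (gates C)"
        using inputs_less[of i] True by (metis circuit_size_def nth_mem)
      then show ?thesis using assms(1) by (fastforce simp: constant_free_def)
    qed (use c in \<open>auto simp: input_step_def split: if_splits\<close>)
    then show ?thesis by (rule unit)
  qed
qed

section \<open>Facts shared by the circuit and the formula\<close>

context
  fixes e q :: nat and Bs :: "('v, 'a) gate list list list" and P :: "nat list list"
  assumes e: "e > 0" and q: "q > 0"
    and blocks: "\<forall>B\<in>set Bs. \<exists>u<Suc t. \<exists>v<Suc t. B = block e u v"
    and products: "P \<noteq> []" "\<forall>js\<in>set P. length js = q" "\<forall>js\<in>set P. \<forall>j\<in>set js. j < length Bs"
begin

lemma leafE: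
  assumes "B \<in> set Bs" "m \<in> set B" "g \<in> set m"
  obtains i j where "i < Suc t" "j < Suc t" "g = const_step i j \<or> g = input_step i j"
  using assms bspec[OF blocks assms(1)] e by (auto elim!: block_leaf)

lemma length_monomial: "B \<in> set Bs \<Longrightarrow> m \<in> set B \<Longrightarrow> length m = 2 * e"
  using blocks by (fastforce simp: block_def)

lemma block_assembly: "depth_four_assembly Bs P"
proof
  show "is_input g" if "B \<in> set Bs" "m \<in> set B" "g \<in> set m" for B m g
    using leafE[OF that] step_is_input by metis
  show "m \<noteq> []" if "B \<in> set Bs" "m \<in> set B" for B m
    using length_monomial[OF that] e by auto
  show "B \<noteq> []" if B: "B \<in> set Bs" for B
  proof -
    obtain u v where "B = block e u v" using bspec[OF blocks B] by blast
    then have "length B > 0" by (simp only: length_block) simp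
    then show ?thesis by simp
  qed
  show "js \<noteq> []" if "js \<in> set P" for js
    using bspec[OF products(2) that] q by auto
qed (use products in auto)

interpretation depth_four_assembly Bs P
  by (rule block_assembly)

lemma inputs_from_assembly: "inputs_from C (assemble Bs P)"
  unfolding inputs_from_def
proof (intro ballI impI)
  fix g assume "g \<in> set (gates (assemble Bs P))" "is_input g"
  from input_D[OF this] obtain B m where "B \<in> set Bs" "m \<in> set B" "g \<in> set m" .
  from leafE[OF this] obtain i j where "g = const_step i j \<or> g = input_step i j" .
  then show "g \<in> set (gates C) \<or> (\<exists>c. g = Const_Gate c)" using step_from by metis
qed

lemma input_constants_assembly:
  assumes "constant_free C" "ordinary_additions C"
  shows "input_constants_int_le (assemble Bs P) (2 ^ t)"
  unfolding input_constants_int_le_def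
proof (intro allI impI)
  fix c assume "Const_Gate c \<in> set (gates (assemble Bs P))"
  from input_D[OF this] obtain B m where "B \<in> set Bs" "m \<in> set B" "Const_Gate c \<in> set m" by auto
  from leafE[OF this] obtain i j where "i < Suc t"
    "Const_Gate c = const_step i j \<or> Const_Gate c = input_step i j" .
  then show "\<exists>n::int. c = of_int n \<and> \<bar>n\<bar> \<le> 2 ^ t" by (rule step_bound[OF assms])
qed

lemma mult_fan_in_assembly:
  assumes "real (2 * e) \<le> r" "real q \<le> r"
  shows "mult_fan_in_le (assemble Bs P) r"
  by (rule mult_fan_in_D) (use length_monomial products(2) assms in auto)

lemma num_mult_gates_assembly:
  "num_mult_gates (assemble Bs P) = length Bs * Suc t ^ (2 * e - 1) + length P"
proof -
  have "map length Bs = map (\<lambda>_. Suc t ^ (2 * e - 1)) Bs"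
    using blocks by (intro map_cong) fastforce+
  then have "sum_list (map length Bs) = length Bs * Suc t ^ (2 * e - 1)"
    by (simp only: sum_list_triv of_nat_id)
  then show ?thesis by (simp only: num_mult_gates_D)
qed

lemmas assembly_facts = depth_four_circuit_D depth_four_formula_D computed_poly_D
  unweighted_additions_D num_add_gates_D num_mult_gates_assembly inputs_from_assembly
  mult_fan_in_assembly input_constants_assembly

end

text \<open>All \<open>n * n\<close> blocks are built once and shared; the products range over the
  walks of \<open>q\<close> steps from \<open>out\<close> to \<open>t\<close> in the matrix of
  blocks.\<close>

lemma exists_depth_four_circuit:
  assumes "e > 0" "q > 0" "formal_degree C \<le> e * q" "real (2 * e) \<le> r" "real q \<le> r"
  shows "\<exists>D :: ('v, 'a) circuit. depth_four_circuit D \<and> computed_poly D = computed_poly C \<and>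
    unweighted_additions D \<and> num_add_gates D = (Suc t)\<^sup>2 + 1 \<and>
    num_mult_gates D = (Suc t)\<^sup>2 * Suc t ^ (2 * e - 1) + Suc t ^ (q - 1) \<and>
    inputs_from C D \<and> mult_fan_in_le D r \<and>
    (constant_free C \<and> ordinary_additions C \<longrightarrow> input_constants_int_le D (2 ^ t))"
proof -
  define n where "n = Suc t"
  \<comment> \<open>Row-major numbering: the block from \<open>u\<close> to \<open>v\<close> has
    index \<open>u * n + v\<close>.\<close>
  define Bs where "Bs = map (\<lambda>i. block e (i div n) (i mod n)) [0..<n * n]"
  define P where "P = map (\<lambda>vs. walk (replicate q (\<lambda>u v. u * n + v)) out vs t)
    (List.n_lists (q - 1) [0..<n])"
  have n: "n > 0" "out < n" "t < n" using out_less by (simp_all add: n_def)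
  have index: "u * n + v < n * n" if "u < n" "v < n" for u v
  proof -
    have "u * n + v < Suc u * n" using that by simp
    also have "\<dots> \<le> n * n" using that by (intro mult_le_mono1) simp
    finally show ?thesis .
  qed
  have *: "\<exists>u<Suc t. \<exists>v<Suc t. B = block e u v" if B: "B \<in> set Bs" for B
  proof -
    obtain i where i: "i < n * n" "B = block e (i div n) (i mod n)"
      using B by (auto simp: Bs_def)
    have "i div n < n" "i mod n < n" using i(1) n by (simp_all add: less_mult_imp_div_less)
    with i(2) show ?thesis unfolding n_def by blast
  qed
  have P_len: "length P = n ^ (q - 1)" by (simp add: P_def)
  then have P: "P \<noteq> []" using n by auto
  have P_q: "length js = q" if "js \<in> set P" for js
    using that by (auto simp: P_def)
  have P_index: "j < length Bs" if js: "js \<in> set P" "j \<in> set js" for js j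
  proof -
    obtain vs where "js = walk (replicate q (\<lambda>u v. u * n + v)) out vs t"
      "length vs = q - 1" "set vs \<subseteq> {0..<n}"
      using js(1) set_n_lists_upt[of _ "q - 1" n] unfolding P_def by auto
    with set_walk[of j "replicate q (\<lambda>u v. u * n + v)" out vs t n] js(2) n assms(2)
    obtain u v where "u < n" "v < n" "j = u * n + v" by auto
    with index show ?thesis by (simp add: Bs_def)
  qed
  have blocks: "\<forall>B\<in>set Bs. \<exists>u<Suc t. \<exists>v<Suc t. B = block e u v"
    and products: "\<forall>js\<in>set P. length js = q" "\<forall>js\<in>set P. \<forall>j\<in>set js. j < length Bs"
    using * P_q P_index by blast+
  note facts = assembly_facts[OF assms(1,2) blocks P products]
  have "computed_poly (assemble Bs P) =
      mat_prod n (map (\<lambda>m u v. block_value (Bs ! m u v)) (replicate q (\<lambda>u v. u * n + v))) out t"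
    using sum_walks[of "replicate q (\<lambda>u v. u * n + v)" t n "\<lambda>j. block_value (Bs ! j)" out] assms n
    unfolding facts(3) unfolding P_def by (simp add: comp_def)
  also have "\<dots> = mat_prod n
      (replicate q (mat_prod n (map (\<lambda>m u v. leaf_value (m u v)) (steps e)))) out t"
    by (rule mat_prod_cong)
      (use n index assms in \<open>simp_all add: Bs_def block_value_block flip: n_def\<close>)
  also have "\<dots> = computed_poly C"
    unfolding n_def by (rule computed_poly_eq_mat_prod[symmetric, OF assms(3)])
  finally have poly: "computed_poly (assemble Bs P) = computed_poly C" .
  have len: "length Bs = (Suc t)\<^sup>2" by (simp add: Bs_def n_def power2_eq_square)
  show ?thesis
    by (rule exI[of _ "assemble Bs P"])
      (use facts poly len P_len assms in \<open>simp add: n_def\<close>)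
qed

text \<open>Sharing is undone: each walk gets its own \<open>q\<close> copies of blocks, so there
  are \<open>q * n ^ (q - 1)\<close> blocks in place of \<open>n * n\<close>.\<close>

lemma exists_depth_four_formula:
  assumes "e > 0" "q > 0" "formal_degree C \<le> e * q" "real (2 * e) \<le> r" "real q \<le> r"
  shows "\<exists>D :: ('v, 'a) circuit. depth_four_formula D \<and> computed_poly D = computed_poly C \<and>
    unweighted_additions D \<and> num_add_gates D = q * Suc t ^ (q - 1) + 1 \<and>
    num_mult_gates D = q * Suc t ^ (q - 1) * Suc t ^ (2 * e - 1) + Suc t ^ (q - 1) \<and>
    inputs_from C D \<and> mult_fan_in_le D r \<and>
    (constant_free C \<and> ordinary_additions C \<longrightarrow> input_constants_int_le D (2 ^ t))"
proof -
  define n where "n = Suc t"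
  define Ts where "Ts = map (\<lambda>vs. walk (replicate q (block e)) out vs t)
    (List.n_lists (q - 1) [0..<n])"
  define Bs where "Bs = concat Ts"
  \<comment> \<open>Consecutive numbering gives \<open>concat P\<close> the form that
    \<open>depth_four_formula_D\<close> asks for.\<close>
  define P where "P = ranges 0 (map length Ts)"
  have n: "n > 0" "out < n" "t < n" using out_less by (simp_all add: n_def)
  have len_Ts: "length T = q" if "T \<in> set Ts" for T
    using that by (auto simp: Ts_def)
  then have "map length Ts = map (\<lambda>_. q) Ts" by (intro map_cong) simp_all
  then have "length Bs = length Ts * q"
    by (simp only: Bs_def length_concat sum_list_triv of_nat_id)
  then have len: "length Bs = q * n ^ (q - 1)" by (simp add: Ts_def)
  have *: "\<exists>u<Suc t. \<exists>v<Suc t. B = block e u v" if B: "B \<in> set Bs" for B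
  proof -
    obtain vs where "B \<in> set (walk (replicate q (block e)) out vs t)"
      "length vs = q - 1" "set vs \<subseteq> {0..<n}"
      using B set_n_lists_upt[of _ "q - 1" n] unfolding Bs_def Ts_def by auto
    with set_walk[of B "replicate q (block e)" out vs t n] n assms(2)
    obtain u v where "u < n" "v < n" "B = block e u v" by auto
    then show ?thesis unfolding n_def by blast
  qed
  have P_len: "length P = n ^ (q - 1)" by (simp add: P_def Ts_def)
  then have P: "P \<noteq> []" using n by auto
  have P_q: "length js = q" if "js \<in> set P" for js
    using length_in_ranges[of js 0 "map length Ts"] that len_Ts by (auto simp: P_def)
  have concat_P: "concat P = [0..<length Bs]"
    by (simp add: P_def concat_ranges Bs_def length_concat)
  then have P_index: "j < length Bs" if "js \<in> set P" "j \<in> set js" for js j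
    using that by (metis UN_I atLeastLessThan_iff set_concat set_upt)
  have blocks: "\<forall>B\<in>set Bs. \<exists>u<Suc t. \<exists>v<Suc t. B = block e u v"
    and products: "\<forall>js\<in>set P. length js = q" "\<forall>js\<in>set P. \<forall>j\<in>set js. j < length Bs"
    using * P_q P_index by blast+
  note facts = assembly_facts[OF assms(1,2) blocks P products]
  have Ts: "map (map (\<lambda>j. block_value (Bs ! j))) P = map (map block_value) Ts"
    unfolding P_def Bs_def
    by (rule map_ranges) (rule nth_equalityI, simp_all)
  have "computed_poly (assemble Bs P) =
      sum_list (map prod_list (map (map (\<lambda>j. block_value (Bs ! j))) P))"
    by (simp add: facts(3) comp_def)
  also have "\<dots> = (\<Sum>T\<leftarrow>Ts. \<Prod>B\<leftarrow>T. block_value B)"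
    unfolding Ts by (simp add: comp_def)
  also have "\<dots> =
      mat_prod n (map (\<lambda>m u v. block_value (m u v)) (replicate q (block e))) out t"
    using sum_walks[of "replicate q (block e)" t n block_value out] assms n
    by (simp add: Ts_def comp_def)
  also have "\<dots> = mat_prod n
      (replicate q (mat_prod n (map (\<lambda>m u v. leaf_value (m u v)) (steps e)))) out t"
    by (rule mat_prod_cong)
      (use n assms in \<open>simp_all add: block_value_block flip: n_def\<close>)
  also have "\<dots> = computed_poly C"
    unfolding n_def by (rule computed_poly_eq_mat_prod[symmetric, OF assms(3)])
  finally have poly: "computed_poly (assemble Bs P) = computed_poly C" .
  show ?thesis
    by (rule exI[of _ "assemble Bs P"])
      (use facts poly len P_len concat_P assms in \<open>simp add: n_def\<close>)
qed

end

section \<open>Choice of parameters and gate counts\<close>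

text \<open>For \<open>k = 2 * m + 1\<close> three times the right side is
  \<open>6 * (m * m) + 9 * m + 3\<close>, above the given bound on \<open>3 * d\<close>. For
  \<open>k = 2 * m\<close> it is \<open>6 * (m * m)\<close>, to be compared with
  \<open>4 * (m * m) + 4 * m\<close>.\<close>

lemma block_dimensions:
  fixes d k :: nat
  assumes "3 * d < (k + 1)\<^sup>2"
  shows "d \<le> (k + 1) div 2 * k"
proof (cases "even k")
  case True
  then obtain m where k: "k = 2 * m" by blast
  show ?thesis
  proof (cases "m \<ge> 2")
    case True
    have "3 * d \<le> 4 * (m * m) + 4 * m" using assms by (simp add: k power2_eq_square algebra_simps)
    moreover have "2 * m \<le> m * m" using True by simp
    ultimately have "d \<le> 2 * (m * m)" by linarith
    then show ?thesis by (simp add: k algebra_simps)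
  next
    \<comment> \<open>At \<open>m = 1\<close> the estimate \<open>2 * m \<le> m * m\<close> fails,
      but there the hypothesis reads \<open>3 * d < 9\<close>, which leaves \<open>d \<le> 2\<close>
      as required.\<close>
    case False
    then have "m = 0 \<or> m = 1" by auto
    with assms show ?thesis by (auto simp: k power2_eq_square)
  qed
next
  case False
  then obtain m where k: "k = 2 * m + 1" by (auto elim: oddE)
  have "3 * d \<le> 4 * (m * m) + 8 * m + 3" using assms by (simp add: k power2_eq_square algebra_simps)
  then have "d \<le> 2 * (m * m) + 3 * m + 1" by linarith
  then show ?thesis by (simp add: k algebra_simps)
qed

theorem theorem4:
  fixes C :: "('v, 'a::field) circuit" and t d :: nat
  assumes "is_circuit C"
    and "weakly_skew C"
    and "circuit_size C = t"
    and "formal_degree C = d"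
  shows "(\<exists>\<Gamma> :: ('v, 'a) circuit.
            depth_four_circuit \<Gamma> \<and>
            computed_poly \<Gamma> = computed_poly C \<and>
            unweighted_additions \<Gamma> \<and>
            num_add_gates \<Gamma> \<le> (t + 1)\<^sup>2 + 1 \<and>
            real (num_mult_gates \<Gamma>) \<le> 2 * real (t + 1) powr (sqrt (3 * real d) + 2) \<and>
            inputs_from C \<Gamma> \<and>
            mult_fan_in_le \<Gamma> (sqrt (3 * real d) + 1) \<and>
            (constant_free C \<and> ordinary_additions C \<longrightarrow> input_constants_int_le \<Gamma> (2 ^ t)))
       \<and> (\<exists>\<Gamma>\<^sub>f :: ('v, 'a) circuit.
            depth_four_formula \<Gamma>\<^sub>f \<and>
            computed_poly \<Gamma>\<^sub>f = computed_poly C \<and>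
            unweighted_additions \<Gamma>\<^sub>f \<and>
            real (num_add_gates \<Gamma>\<^sub>f) \<le> real (t + 1) powr sqrt (3 * real d) + 1 \<and>
            real (num_mult_gates \<Gamma>\<^sub>f) \<le> 2 * real (t + 1) powr (2 * sqrt (3 * real d)) \<and>
            inputs_from C \<Gamma>\<^sub>f \<and>
            mult_fan_in_le \<Gamma>\<^sub>f (sqrt (3 * real d) + 1) \<and>
            (constant_free C \<and> ordinary_additions C \<longrightarrow> input_constants_int_le \<Gamma>\<^sub>f (2 ^ t)))"
proof -
  interpret weakly_skew_circuit C using assms(1,2) by unfold_locales
  define s where "s = sqrt (3 * real d)"
  define k where "k = nat \<lfloor>s\<rfloor>"
  define e where "e = (k + 1) div 2"
  define n where "n = t + 1"
  have n: "Suc t = n" "n \<ge> 1" by (simp_all add: n_def)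
  have d: "d \<ge> 1" using deg_pos[OF out_less] assms(4) by (simp add: formal_degree_def)
  have "d \<le> t" using formal_degree_le_size assms(3,4) by simp
  have "s \<ge> 1" using d by (simp add: s_def)
  then have k: "k \<ge> 1" "real k \<le> s" "s < real k + 1" unfolding k_def by linarith+
  have s2: "s\<^sup>2 = 3 * real d" by (simp add: s_def)
  have "s\<^sup>2 < (real k + 1)\<^sup>2" using k \<open>s \<ge> 1\<close> by (intro power_strict_mono) auto
  then have "real (3 * d) < real ((k + 1)\<^sup>2)" by (simp add: s2 add.commute)
  then have de: "d \<le> e * k" unfolding e_def by (intro block_dimensions) linarith
  \<comment> \<open>This absorbs the factor \<open>k\<close> in the number of blocks of the formula
    into one more power of \<open>n\<close>.\<close>
  have "k \<le> n"
  proof -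
    have "(real k)\<^sup>2 \<le> s\<^sup>2" using k by (intro power_mono) auto
    also have "\<dots> \<le> 3 * real t" using \<open>d \<le> t\<close> by (simp add: s2)
    \<comment> \<open>A nonnegative square gives t^2 + 1 >= 2 t, hence 3 t <= (t + 1)^2.\<close>
    also have "\<dots> \<le> (real n)\<^sup>2"
      using zero_le_power2[of "real t - 1"] by (simp add: n_def power2_eq_square algebra_simps)
    finally show ?thesis using power2_le_imp_le[of "real k" "real n"] by simp
  qed
  have e: "e > 0" "2 * e - 1 \<le> k" "2 * e \<le> k + 1" using k by (auto simp: e_def)
  have deg: "formal_degree C \<le> e * k" using de assms(4) by simp
  have fan: "real (2 * e) \<le> s + 1" "real k \<le> s + 1"
  proof -
    have "real (2 * e) \<le> real (k + 1)" using e(3) by (rule of_nat_mono)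
    then show "real (2 * e) \<le> s + 1" using k by simp
  qed (use k in simp)
  have powr: "real (n ^ a) \<le> real n powr x" if "real a \<le> x" for a x
  proof -
    have "real (n ^ a) = real n powr real a" using n by (simp add: powr_realpow)
    also have "\<dots> \<le> real n powr x" using n that by (intro powr_mono) auto
    finally show ?thesis .
  qed
  have pow: "n ^ a \<le> n ^ b" if "a \<le> b" for a b
    using n that by (intro power_increasing) auto
  have "k * n ^ (k - 1) \<le> n * n ^ (k - 1)" using \<open>k \<le> n\<close> by (rule mult_le_mono1)
  also have "\<dots> = n ^ k" using power_minus_mult[of k n] k(1) by (simp add: mult.commute)
  finally have adds: "k * n ^ (k - 1) \<le> n ^ k" .
  \<comment> \<open>The exponent 2 counts the pairs of end vertices of a block, and
    \<open>2 * e - 1 \<le> k\<close> its interior vertices; the upper products number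
    \<open>n ^ (k - 1)\<close>.\<close>
  have "n ^ (2 + (2 * e - 1)) + n ^ (k - 1) \<le> n ^ (k + 2) + n ^ (k + 2)"
    by (rule add_mono; rule pow) (use e in simp_all)
  also have "\<dots> = 2 * n ^ (k + 2)" by simp
  finally have "n\<^sup>2 * n ^ (2 * e - 1) + n ^ (k - 1) \<le> 2 * n ^ (k + 2)" by (simp only: power_add)
  then have "real (n\<^sup>2 * n ^ (2 * e - 1) + n ^ (k - 1)) \<le> real (2 * n ^ (k + 2))"
    by (rule of_nat_mono)
  also have "\<dots> = 2 * real (n ^ (k + 2))" by simp
  also have "\<dots> \<le> 2 * real n powr (s + 2)"
    using powr[of "k + 2" "s + 2"] k by simp
  finally have circuit_mults: "real (n\<^sup>2 * n ^ (2 * e - 1) + n ^ (k - 1)) \<le> 2 * real n powr (s + 2)" .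
  \<comment> \<open>The first factor \<open>n ^ k\<close> bounds the number of blocks, the second
    the number of monomials in each.\<close>
  have "k * n ^ (k - 1) * n ^ (2 * e - 1) + n ^ (k - 1) \<le> n ^ k * n ^ k + n ^ (k + k)"
    by (rule add_mono[OF mult_le_mono[OF adds]]; rule pow) (use e in simp_all)
  also have "\<dots> = 2 * n ^ (2 * k)" by (simp add: power_add mult_2)
  finally have "real (k * n ^ (k - 1) * n ^ (2 * e - 1) + n ^ (k - 1)) \<le> real (2 * n ^ (2 * k))"
    by (rule of_nat_mono)
  also have "\<dots> = 2 * real (n ^ (2 * k))" by simp
  also have "\<dots> \<le> 2 * real n powr (2 * s)"
    using powr[of "2 * k" "2 * s"] k by simp
  finally have formula_mults:
    "real (k * n ^ (k - 1) * n ^ (2 * e - 1) + n ^ (k - 1)) \<le> 2 * real n powr (2 * s)" .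
  have "real (k * n ^ (k - 1)) \<le> real (n ^ k)" using adds by (rule of_nat_mono)
  also have "\<dots> \<le> real n powr s" by (rule powr) (rule k)
  finally have formula_adds: "real (k * n ^ (k - 1) + 1) \<le> real n powr s + 1" by simp
  have k0: "k > 0" using k by simp
  obtain D :: "('v, 'a) circuit" where D: "depth_four_circuit D" "computed_poly D = computed_poly C"
    "unweighted_additions D" "num_add_gates D = n\<^sup>2 + 1"
    "num_mult_gates D = n\<^sup>2 * n ^ (2 * e - 1) + n ^ (k - 1)"
    "inputs_from C D" "mult_fan_in_le D (s + 1)"
    "constant_free C \<and> ordinary_additions C \<longrightarrow> input_constants_int_le D (2 ^ t)"
    using exists_depth_four_circuit[OF e(1) k0 deg fan] unfolding assms(3) n(1) by blast
  obtain E :: "('v, 'a) circuit" where E: "depth_four_formula E" "computed_poly E = computed_poly C"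
    "unweighted_additions E" "num_add_gates E = k * n ^ (k - 1) + 1"
    "num_mult_gates E = k * n ^ (k - 1) * n ^ (2 * e - 1) + n ^ (k - 1)"
    "inputs_from C E" "mult_fan_in_le E (s + 1)"
    "constant_free C \<and> ordinary_additions C \<longrightarrow> input_constants_int_le E (2 ^ t)"
    using exists_depth_four_formula[OF e(1) k0 deg fan] unfolding assms(3) n(1) by blast
  show ?thesis
    unfolding s_def[symmetric] n_def[symmetric]
  proof (rule conjI, goal_cases)
    case 1
    from D circuit_mults show ?case by (intro exI[of _ D]) simp
  next
    case 2
    from E formula_adds formula_mults show ?case by (intro exI[of _ E]) simp
  qed
qed

end
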